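(* Let $\ell\ge1$ be a fixed integer and for $d\ge1$ let $G,H:\mathbb C^\ell\to\mathbb C^d\otimes\mathbb C^d$ be independent random linear maps whose matrix entries are i.i.d. standard complex Gaussian random variables (Ginibre matrices). Define the completely positive maps $\Phi_G,\Phi_H:\mathcal M_\ell(\mathbb C)\to\mathcal M_d(\mathbb C)$ by $\Phi_G(X)=[\mathrm{id}_d\otimes\mathrm{Tr}_d](GXG^* )$ and $\Phi_H(X)=[\mathrm{id}_d\otimes\mathrm{Tr}_d](HXH^* )$, and let $Z=[\Phi_G\otimes\Phi_H](\omega_\ell)\in\mathcal M_{d^2}(\mathbb C)$. Then for all $n\ge1$, $$m_n(\ell)=\lim_{d\to\infty}\mathbb E\,\frac1{d^2}\mathrm{Tr}\left(\frac{Z}{d^2}\right)^n,\qquad\text{where } m_n(\ell)=\sum_{\alpha,\beta\in\mathrm{NC}(n)}\ell^{\#(\alpha^{-1}\beta)}.$$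
   Context: $\mathrm{NC}(n)$ is the set of non-crossing partitions of $[n]$, each identified with the permutation in $\mathcal S_n$ whose cycles are its blocks with elements listed in increasing order; $\#\sigma$ is the number of cycles of a permutation. For a fixed orthonormal basis $(e_i)$ of $\mathbb C^\ell$, $\Omega_\ell=\sum_{i=1}^\ell e_i\otimes e_i$ and $\omega_\ell=\Omega_\ell\Omega_\ell^*\in\mathcal M_{\ell^2}(\mathbb C)$. $\mathrm{Tr}_d$ denotes the partial trace over the second tensor factor $\mathbb C^d$. *)

theory Defs
  imports
    "HOL-Probability.Probability"
    "HOL-Combinatorics.Cycles"
    "HOL-Combinatorics.Orbits"
    "Jordan_Normal_Form.Schur_Decomposition"
begin

unbundle no vec_syntax

section \<open>Non-crossing partitions as permutations\<close>

definition noncrossing :: "nat set set \<Rightarrow> bool" where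
  "noncrossing P \<longleftrightarrow>
     (\<forall>A\<in>P. \<forall>B\<in>P. \<forall>a b c d. a < b \<longrightarrow> b < c \<longrightarrow> c < d \<longrightarrow>
        a \<in> A \<longrightarrow> c \<in> A \<longrightarrow> b \<in> B \<longrightarrow> d \<in> B \<longrightarrow> A = B)"

definition NC :: "nat \<Rightarrow> nat set set set" where
  "NC n = {P. partition_on {1..n} P \<and> noncrossing P}"

definition perm_of_partition :: "nat set set \<Rightarrow> nat \<Rightarrow> nat" where
  "perm_of_partition P x =
     (if x \<in> \<Union>P then cycle_of_list (sorted_list_of_set (THE B. B \<in> P \<and> x \<in> B)) x else x)"

text \<open>Cycles of a permutation of \<open>{1..n}\<close>; fixed points count as cycles of length one.\<close>

definition num_cycles :: "nat \<Rightarrow> (nat \<Rightarrow> nat) \<Rightarrow> nat" where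
  "num_cycles n \<sigma> = card (orbit \<sigma> ` {1..n})"

definition nc_moment :: "nat \<Rightarrow> nat \<Rightarrow> nat" where
  "nc_moment n l = (\<Sum>P\<in>NC n. \<Sum>Q\<in>NC n.
     l ^ num_cycles n (Hilbert_Choice.inv (perm_of_partition P) \<circ> perm_of_partition Q))"


section \<open>Tensor products of matrices and of maps on matrices\<close>

text \<open>Throughout, \<open>\<complex>\<^sup>a \<otimes> \<complex>\<^sup>b\<close> is identified with \<open>\<complex>\<^sup>a\<^sup>b\<close> by numbering the product basis
  lexicographically: \<open>(i, k)\<close> with \<open>i < a\<close>, \<open>k < b\<close> has index \<open>i * b + k\<close>.\<close>

definition kron_vec :: "complex Matrix.vec \<Rightarrow> complex Matrix.vec \<Rightarrow> complex Matrix.vec" where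
  "kron_vec v w = Matrix.vec (dim_vec v * dim_vec w)
     (\<lambda>p. v $ (p div dim_vec w) * w $ (p mod dim_vec w))"

definition kron_mat :: "complex Matrix.mat \<Rightarrow> complex Matrix.mat \<Rightarrow> complex Matrix.mat" where
  "kron_mat A B = Matrix.mat (dim_row A * dim_row B) (dim_col A * dim_col B)
     (\<lambda>(p, q). A $$ (p div dim_row B, q div dim_col B) * B $$ (p mod dim_row B, q mod dim_col B))"

definition mat_trace :: "complex Matrix.mat \<Rightarrow> complex" where
  "mat_trace A = (\<Sum>i<dim_row A. A $$ (i, i))"

definition partial_trace2 :: "nat \<Rightarrow> nat \<Rightarrow> complex Matrix.mat \<Rightarrow> complex Matrix.mat" where
  "partial_trace2 a b X =
     Matrix.mat a a (\<lambda>(i, j). \<Sum>k<b. X $$ (i * b + k, j * b + k))"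

definition matrix_unit :: "nat \<Rightarrow> nat \<Rightarrow> nat \<Rightarrow> complex Matrix.mat" where
  "matrix_unit a i j = Matrix.mat a a (\<lambda>(p, q). if p = i \<and> q = j then 1 else 0)"

text \<open>For linear maps \<open>\<Phi>\<close> on \<open>a\<times>a\<close> matrices and \<open>\<Psi>\<close> on \<open>b\<times>b\<close> matrices, with values in
  \<open>c\<times>c\<close> and \<open>d\<times>d\<close> matrices: the linear extension of
  \<open>E\<^sub>i\<^sub>j \<otimes> E\<^sub>k\<^sub>m \<mapsto> \<Phi>(E\<^sub>i\<^sub>j) \<otimes> \<Psi>(E\<^sub>k\<^sub>m)\<close>.\<close>

definition tensor_map ::
  "nat \<Rightarrow> nat \<Rightarrow> nat \<Rightarrow> nat \<Rightarrow> (complex Matrix.mat \<Rightarrow> complex Matrix.mat) \<Rightarrow>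
   (complex Matrix.mat \<Rightarrow> complex Matrix.mat) \<Rightarrow> complex Matrix.mat \<Rightarrow> complex Matrix.mat" where
  "tensor_map a b c d \<Phi> \<Psi> X = Matrix.mat (c * d) (c * d) (\<lambda>pq.
     \<Sum>i<a. \<Sum>j<a. \<Sum>k<b. \<Sum>m<b.
       X $$ (i * b + k, j * b + m) *
       kron_mat (\<Phi> (matrix_unit a i j)) (\<Psi> (matrix_unit b k m)) $$ pq)"

text \<open>Orthonormality of \<open>l\<close> vectors of \<open>\<complex>\<^sup>l\<close> already makes them a basis.\<close>

definition orthonormal_basis :: "nat \<Rightarrow> (nat \<Rightarrow> complex Matrix.vec) \<Rightarrow> bool" where
  "orthonormal_basis l e \<longleftrightarrow>
     (\<forall>i<l. e i \<in> carrier_vec l) \<and>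
     (\<forall>i<l. \<forall>j<l. e i \<bullet>c e j = (if i = j then 1 else 0))"

definition Omega_vec :: "nat \<Rightarrow> (nat \<Rightarrow> complex Matrix.vec) \<Rightarrow> complex Matrix.vec" where
  "Omega_vec l e = Matrix.vec (l * l) (\<lambda>p. \<Sum>i<l. kron_vec (e i) (e i) $ p)"

definition omega_mat :: "nat \<Rightarrow> (nat \<Rightarrow> complex Matrix.vec) \<Rightarrow> complex Matrix.mat" where
  "omega_mat l e = mat_of_cols (l * l) [Omega_vec l e] *
                   mat_adjoint (mat_of_cols (l * l) [Omega_vec l e])"

definition cp_map :: "nat \<Rightarrow> complex Matrix.mat \<Rightarrow> complex Matrix.mat \<Rightarrow> complex Matrix.mat" where
  "cp_map d G X = partial_trace2 d d (G * X * mat_adjoint G)"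

definition Z_mat ::
  "nat \<Rightarrow> (nat \<Rightarrow> complex Matrix.vec) \<Rightarrow> nat \<Rightarrow> complex Matrix.mat \<Rightarrow> complex Matrix.mat \<Rightarrow>
   complex Matrix.mat" where
  "Z_mat l e d G H = tensor_map l l d d (cp_map d G) (cp_map d H) (omega_mat l e)"

lemma index_pair_less: "i * b + k < a * b" if "i < a" "k < b" for i k a b :: nat
proof -
  have "i * b + k < Suc i * b" using that by simp
  also have "\<dots> \<le> a * b" using that by (intro mult_le_mono1) simp
  finally show ?thesis .
qed

text \<open>The defining property of the tensor product of two linear maps: the hypotheses say that
  \<open>\<Phi>(A) = \<Sum> A\<^sub>i\<^sub>j \<Phi>(E\<^sub>i\<^sub>j)\<close> and likewise for \<open>\<Psi>\<close>.\<close>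

lemma tensor_map_kron:
  assumes A: "A \<in> carrier_mat a a" and B: "B \<in> carrier_mat b b"
    and dim: "\<And>X. \<Phi> X \<in> carrier_mat c c" "\<And>X. \<Psi> X \<in> carrier_mat d d"
    and \<Phi>: "\<And>p q. p < c \<Longrightarrow> q < c \<Longrightarrow>
          \<Phi> A $$ (p, q) = (\<Sum>i<a. \<Sum>j<a. A $$ (i, j) * \<Phi> (matrix_unit a i j) $$ (p, q))"
    and \<Psi>: "\<And>p q. p < d \<Longrightarrow> q < d \<Longrightarrow>
          \<Psi> B $$ (p, q) = (\<Sum>k<b. \<Sum>m<b. B $$ (k, m) * \<Psi> (matrix_unit b k m) $$ (p, q))"
  shows "tensor_map a b c d \<Phi> \<Psi> (kron_mat A B) = kron_mat (\<Phi> A) (\<Psi> B)"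
proof (rule eq_matI)
  have [simp]: "dim_row (\<Phi> X) = c" "dim_col (\<Phi> X) = c" "dim_row (\<Psi> X) = d" "dim_col (\<Psi> X) = d"
    for X using dim[of X] by auto
  have [simp]: "dim_row A = a" "dim_col A = a" "dim_row B = b" "dim_col B = b"
    using A B by auto
  show "dim_row (tensor_map a b c d \<Phi> \<Psi> (kron_mat A B)) = dim_row (kron_mat (\<Phi> A) (\<Psi> B))"
    "dim_col (tensor_map a b c d \<Phi> \<Psi> (kron_mat A B)) = dim_col (kron_mat (\<Phi> A) (\<Psi> B))"
    by (auto simp: tensor_map_def kron_mat_def)
  fix p q assume "p < dim_row (kron_mat (\<Phi> A) (\<Psi> B))" "q < dim_col (kron_mat (\<Phi> A) (\<Psi> B))"
  then have pq: "p < c * d" "q < c * d" by (auto simp: kron_mat_def)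
  then have d: "d > 0" by (cases d) auto
  have lt: "p div d < c" "q div d < c" "p mod d < d" "q mod d < d"
    using pq d by (auto simp: less_mult_imp_div_less)
  have "tensor_map a b c d \<Phi> \<Psi> (kron_mat A B) $$ (p, q) =
     (\<Sum>i<a. \<Sum>j<a. \<Sum>k<b. \<Sum>m<b. (A $$ (i, j) * B $$ (k, m)) *
        (\<Phi> (matrix_unit a i j) $$ (p div d, q div d) *
         \<Psi> (matrix_unit b k m) $$ (p mod d, q mod d)))"
    using pq unfolding tensor_map_def
    by (auto simp: kron_mat_def index_pair_less intro!: sum.cong)
  also have "\<dots> = \<Phi> A $$ (p div d, q div d) * \<Psi> B $$ (p mod d, q mod d)"
    unfolding \<Phi>[OF lt(1,2)] \<Psi>[OF lt(3,4)]
    by (simp only: sum_distrib_right, simp only: sum_distrib_left mult_ac)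
  also have "\<dots> = kron_mat (\<Phi> A) (\<Psi> B) $$ (p, q)"
    using pq by (simp add: kron_mat_def)
  finally show "tensor_map a b c d \<Phi> \<Psi> (kron_mat A B) $$ (p, q) = kron_mat (\<Phi> A) (\<Psi> B) $$ (p, q)" .
qed


section \<open>Ginibre matrices\<close>

text \<open>Normalised so that \<open>E |X|\<^sup>2 = 1\<close>: the real and imaginary parts are independent centred
  Gaussians of variance \<open>1/2\<close>. The second argument of the normal density is the standard
  deviation.\<close>

definition std_complex_gaussian :: "'w measure \<Rightarrow> ('w \<Rightarrow> complex) \<Rightarrow> bool" where
  "std_complex_gaussian M X \<longleftrightarrow>
     prob_space.indep_var M borel (\<lambda>\<omega>. Re (X \<omega>)) borel (\<lambda>\<omega>. Im (X \<omega>)) \<and>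
     distributed M lborel (\<lambda>\<omega>. Re (X \<omega>)) (\<lambda>x. ennreal (normal_density 0 (1 / sqrt 2) x)) \<and>
     distributed M lborel (\<lambda>\<omega>. Im (X \<omega>)) (\<lambda>x. ennreal (normal_density 0 (1 / sqrt 2) x))"

definition ginibre ::
  "'w measure \<Rightarrow> nat \<Rightarrow> nat \<Rightarrow> ('w \<Rightarrow> complex Matrix.mat) \<Rightarrow> bool" where
  "ginibre M r c G \<longleftrightarrow>
     (\<forall>\<omega>\<in>space M. G \<omega> \<in> carrier_mat r c) \<and>
     prob_space.indep_vars M (\<lambda>_. borel) (\<lambda>p \<omega>. G \<omega> $$ p) ({..<r} \<times> {..<c}) \<and>
     (\<forall>p\<in>{..<r} \<times> {..<c}. std_complex_gaussian M (\<lambda>\<omega>. G \<omega> $$ p))"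

text \<open>Independence of two random \<open>r\<times>c\<close> matrices, as random elements of \<open>\<complex>\<^sup>r\<^sup>\<times>\<^sup>c\<close>.\<close>

definition indep_random_mats ::
  "'w measure \<Rightarrow> nat \<Rightarrow> nat \<Rightarrow> ('w \<Rightarrow> complex Matrix.mat) \<Rightarrow> ('w \<Rightarrow> complex Matrix.mat) \<Rightarrow> bool"
where
  "indep_random_mats M r c G H \<longleftrightarrow>
     prob_space.indep_var M
       (PiM ({..<r} \<times> {..<c}) (\<lambda>_. borel)) (\<lambda>\<omega>. restrict (\<lambda>p. G \<omega> $$ p) ({..<r} \<times> {..<c}))
       (PiM ({..<r} \<times> {..<c}) (\<lambda>_. borel)) (\<lambda>\<omega>. restrict (\<lambda>p. H \<omega> $$ p) ({..<r} \<times> {..<c}))"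

end

theory Submission
  imports Defs
begin

text \<open>Let \<open>\<gamma>\<close> be the cycle \<open>(1 2 \<dots> n)\<close>. Expanding the trace and applying Wick's formula to \<open>G\<close> and
  to \<open>H\<close> gives the exact formula
  \<open>E Tr Z\<^sup>n = \<Sum>\<^sub>\<alpha>\<^sub>\<beta> d^(#\<alpha> + #(\<gamma>\<^sup>-\<^sup>1\<alpha>) + #\<beta> + #(\<gamma>\<^sup>-\<^sup>1\<beta>)) \<ell>^#(\<alpha>\<^sup>-\<^sup>1\<beta>)\<close> over all pairs of permutations; the
  orthonormal basis enters only through the unitarity of the matrix \<open>\<Sum>\<^sub>m e\<^sub>m e\<^sub>m\<^sup>T\<close>. After division
  by \<open>d^(2n + 2)\<close> only the pairs survive for which both \<open>\<alpha>\<close> and \<open>\<beta>\<close> attain equality in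
  \<open>#\<alpha> + #(\<gamma>\<^sup>-\<^sup>1\<alpha>) \<le> n + 1\<close>. By induction on \<open>n\<close>, deleting the largest point, these are the
  permutations for which every interval \<open>(x, \<alpha> x)\<close> with \<open>x < \<alpha> x\<close> and every \<open>[\<alpha> x, x]\<close> with
  \<open>\<alpha> x \<le> x\<close> is invariant, and these are exactly the ones coming from non-crossing partitions.\<close>

section \<open>Cycle counts under multiplication by a transposition\<close>

text \<open>Each kind of label accounts for one factor of the exact formula. A permutation \<alpha>
  pairs the entries of \<open>G\<close> with their conjugates. Labels that are traced out must be
  constant on the cycles of \<alpha>, which gives the exponent #\<alpha>; row labels are shifted by
  \<gamma> between consecutive factors of \<open>Z\<close>, which gives
  #(\<open>\<gamma>\<^sup>-\<^sup>1\<close>\<alpha>). The same holds for \<open>H\<close> and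
  \<beta>. Since \<open>G\<close> and \<open>H\<close> share only the labels below \<open>l\<close>,
  these alone compare \<alpha> with \<beta>. The equality case is the hard point. Crossing is a
  relation between blocks, and the permutation of a partition is built from sorted lists; neither is
  convenient when a point is deleted. Nestedness is a condition on the permutation itself, one
  interval per point, and it obeys the same recursion as equality: inserting a new largest point
  with image \<open>m\<close> changes the cycle count of the complement by plus or minus one, and
  for a nested permutation the sign is plus exactly when \<open>{m..n}\<close> is invariant.\<close>

lemma orbit_least:
  assumes "x \<in> A" "\<And>y. y \<in> A \<Longrightarrow> f y \<in> A"
  shows "orbit f x \<subseteq> A"
proof
  fix y assume "y \<in> orbit f x"
  then show "y \<in> A" by induction (auto intro: assms)
qed

lemma orbit_eq_if_mem:
  assumes "permutation f" "y \<in> orbit f x"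
  shows "orbit f y = orbit f x"
  using orbit_cyclic_eq3[OF cyclic_on_orbit'[OF assms(1)] assms(2)] .

text \<open>Multiplying by \<open>transpose p q\<close> on the left redirects the arrow into
  \<open>p\<close> to \<open>q\<close> and the arrow into \<open>q\<close> to \<open>p\<close>. If
  these arrows belong to different cycles, the two cycles are spliced into one, and no other arrow
  changes.\<close>

lemma orbit_transpose_merge:
  assumes s: "permutation s" and pq: "q \<notin> orbit s p"
  shows "orbit (Transposition.transpose p q \<circ> s) p = orbit s p \<union> orbit s q"
    and "orbit (Transposition.transpose p q \<circ> s) q = orbit s p \<union> orbit s q"
    and "x \<notin> orbit s p \<union> orbit s q \<Longrightarrow> orbit (Transposition.transpose p q \<circ> s) x = orbit s x"
proof -
  let ?t = "Transposition.transpose p q \<circ> s"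
  have t: "permutation ?t" using s by (intro permutation_compose permutation_swap_id)
  have sub: "orbit s b \<subseteq> orbit (Transposition.transpose a b \<circ> s) a \<and> orbit s a \<subseteq> orbit (Transposition.transpose a b \<circ> s) a"
    if ab: "b \<notin> orbit s a" for a b
  proof -
    let ?u = "Transposition.transpose a b \<circ> s"
    have u: "permutation ?u" using s by (intro permutation_compose permutation_swap_id)
    have ba: "a \<notin> orbit s b" using ab orbit_eq_if_mem[OF s] permutation_self_in_orbit[OF s] by metis
    have A: "z \<in> orbit ?u a" if "z \<in> orbit s a" for z
      using that
    proof induction
      case base
      have "s a \<noteq> b" using ab orbit.base by metis
      then have "s a = a \<or> ?u a = s a" by (auto simp: Transposition.transpose_def)
      then show ?case using permutation_self_in_orbit[OF u] orbit.base[of ?u a] by metis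
    next
      case (step z)
      have "s z \<noteq> b" using ab orbit.step[OF step(1)] by metis
      then have "s z = a \<or> ?u z = s z" by (auto simp: Transposition.transpose_def)
      then show ?case using permutation_self_in_orbit[OF u] orbit.step[OF step(2)] by metis
    qed
    \<comment> \<open>The predecessor \<open>z\<close> of \<open>a\<close> on its own
      \<open>s\<close>-cycle is the place where the new walk crosses over to
      \<open>b\<close>.\<close>
    have "a \<in> s ` orbit s a"
      using permutation_self_in_orbit[OF s, of a]
      by (cases rule: orbit.cases) (use permutation_self_in_orbit[OF s, of a] in auto)
    then obtain z where z: "z \<in> orbit s a" "s z = a" by auto
    have "?u z = b" using z by simp
    then have b: "b \<in> orbit ?u a" using A[OF z(1)] orbit.step by metis
    have "z \<in> orbit ?u a" if "z \<in> orbit s b" for z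
      using that
    proof induction
      case base
      have "s b \<noteq> a" using ba orbit.base by metis
      then have "s b = b \<or> ?u b = s b" by (auto simp: Transposition.transpose_def)
      then show ?case using b orbit.step[OF b] by metis
    next
      case (step z)
      have "s z \<noteq> a" using ba orbit.step[OF step(1)] by metis
      then have "s z = b \<or> ?u z = s z" by (auto simp: Transposition.transpose_def)
      then show ?case using b orbit.step[OF step(2)] by metis
    qed
    with A show ?thesis by blast
  qed
  have "orbit ?t p \<subseteq> orbit s p \<union> orbit s q"
  proof (rule orbit_least)
    show "p \<in> orbit s p \<union> orbit s q" using permutation_self_in_orbit[OF s] by auto
    fix y assume "y \<in> orbit s p \<union> orbit s q"
    then have "s y \<in> orbit s p \<union> orbit s q" using orbit.step by fastforce
    then show "?t y \<in> orbit s p \<union> orbit s q"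
      using permutation_self_in_orbit[OF s] by (auto simp: Transposition.transpose_def)
  qed
  then show P: "orbit ?t p = orbit s p \<union> orbit s q" using sub[OF pq] by blast
  have "q \<in> orbit ?t p" unfolding P using permutation_self_in_orbit[OF s] by auto
  then show "orbit ?t q = orbit s p \<union> orbit s q" using orbit_eq_if_mem[OF t] P by metis
  assume x: "x \<notin> orbit s p \<union> orbit s q"
  show "orbit ?t x = orbit s x"
  proof (rule orbit_cong)
    show "x \<in> orbit s x" by (rule permutation_self_in_orbit[OF s])
    fix y assume y: "y \<in> orbit s x"
    then have "s y \<in> orbit s x" by (rule orbit.step)
    then have "s y \<noteq> p" "s y \<noteq> q"
      using x orbit_eq_if_mem[OF s] permutation_self_in_orbit[OF s] by (metis Un_iff)+
    then show "?t y = s y" by (simp add: Transposition.transpose_def)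
  qed
qed

text \<open>The set of orbits trades two distinct members for their union, which was not an orbit
  before.\<close>

lemma card_orbits_transpose_merge:
  assumes s: "s permutes S" "finite S" and pq: "p \<in> S" "q \<in> S" "q \<notin> orbit s p"
  shows "Suc (card (orbit (Transposition.transpose p q \<circ> s) ` S)) = card (orbit s ` S)"
proof -
  let ?t = "Transposition.transpose p q \<circ> s"
  let ?P = "orbit s p" and ?Q = "orbit s q"
  have ps: "permutation s" using s by (metis permutation_permutes)
  note self = permutation_self_in_orbit[OF ps]
  note oeq = orbit_eq_if_mem[OF ps]
  have sub: "?P \<subseteq> S" "?Q \<subseteq> S" using permutes_orbit_subset s pq by metis+
  note m = orbit_transpose_merge[OF ps pq(3)]
  have tp: "permutation ?t" using ps by (intro permutation_compose permutation_swap_id)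
  have U: "orbit ?t x = ?P \<union> ?Q" if "x \<in> ?P \<union> ?Q" for x
    using orbit_eq_if_mem[OF tp, of x p] m(1) that by auto
  have R: "orbit s ` (S - (?P \<union> ?Q)) = orbit s ` S - {?P, ?Q}"
  proof (intro equalityI subsetI)
    fix A assume "A \<in> orbit s ` (S - (?P \<union> ?Q))"
    then show "A \<in> orbit s ` S - {?P, ?Q}" using self by auto
  next
    fix A assume "A \<in> orbit s ` S - {?P, ?Q}"
    then obtain x where x: "x \<in> S" "A = orbit s x" "A \<noteq> ?P" "A \<noteq> ?Q" by auto
    then have "x \<notin> ?P \<union> ?Q" using oeq by auto
    then show "A \<in> orbit s ` (S - (?P \<union> ?Q))" using x by auto
  qed
  have "(?P \<union> ?Q) \<union> (S - (?P \<union> ?Q)) = S" using sub by auto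
  from arg_cong[OF this, of "image (orbit ?t)"]
  have "orbit ?t ` S = orbit ?t ` (?P \<union> ?Q) \<union> orbit ?t ` (S - (?P \<union> ?Q))"
    unfolding image_Un by (rule sym)
  moreover have "orbit ?t ` (?P \<union> ?Q) = {?P \<union> ?Q}"
  proof -
    have "p \<in> ?P \<union> ?Q" using self by auto
    then show ?thesis using U by (auto intro!: image_eqI[of _ _ p])
  qed
  moreover have "orbit ?t ` (S - (?P \<union> ?Q)) = orbit s ` S - {?P, ?Q}"
    unfolding R[symmetric] using m(3) by (intro image_cong) auto
  ultimately have eq: "orbit ?t ` S = insert (?P \<union> ?Q) (orbit s ` S - {?P, ?Q})" by simp
  have "?P \<union> ?Q \<notin> orbit s ` S"
  proof
    assume "?P \<union> ?Q \<in> orbit s ` S"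
    then obtain x where "orbit s x = ?P \<union> ?Q" by auto
    then have "p \<in> orbit s x" "q \<in> orbit s x" using self by auto
    then have "?P = orbit s x" "?Q = orbit s x" using oeq by auto
    then show False using pq(3) self by auto
  qed
  moreover have ne: "?P \<noteq> ?Q" using pq(3) self by auto
  moreover have mem: "{?P, ?Q} \<subseteq> orbit s ` S" using pq by auto
  moreover have "card (orbit s ` S) \<ge> card {?P, ?Q}" using mem s by (intro card_mono) auto
  ultimately show ?thesis
    unfolding eq using s by (subst card_insert_disjoint) (auto simp: card_Diff_subset)
qed

text \<open>The \<open>s\<close>-cycle through \<open>p\<close> is cut just before it reaches \<open>q\<close>.\<close>

lemma orbit_transpose_split:
  assumes s: "permutation s" and pq: "q \<in> orbit s p" "p \<noteq> q"
  shows "q \<notin> orbit (Transposition.transpose p q \<circ> s) p"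
proof -
  let ?t = "Transposition.transpose p q \<circ> s"
  define k where "k = (LEAST k. (s ^^ k) p = q)"
  have ex: "\<exists>k. (s ^^ k) p = q" using pq(1) orbit_altdef_permutation[OF s] by auto
  have k: "(s ^^ k) p = q" unfolding k_def using ex by (rule LeastI_ex)
  have kmin: "(s ^^ i) p \<noteq> q" if "i < k" for i using that unfolding k_def by (metis not_less_Least)
  have k0: "k > 0" using k pq(2) by (cases k) auto
  \<comment> \<open>A return to \<open>p\<close> at time \<open>i\<close> would let the walk reach
    \<open>q\<close> already at time \<open>k - i\<close>, against the minimality of
    \<open>k\<close>.\<close>
  have np: "(s ^^ i) p \<noteq> p" if "0 < i" "i < k" for i
  proof
    assume a: "(s ^^ i) p = p"
    have "(s ^^ (k - i)) p = (s ^^ (k - i)) ((s ^^ i) p)" using a by simp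
    also have "\<dots> = (s ^^ (k - i + i)) p" by (simp add: funpow_add)
    also have "\<dots> = q" using k that by simp
    finally show False using kmin[of "k - i"] that by auto
  qed
  have "orbit ?t p \<subseteq> {(s ^^ i) p | i. i < k}"
  proof (rule orbit_least)
    show "p \<in> {(s ^^ i) p | i. i < k}" using k0 by (auto intro!: exI[of _ 0])
    fix y assume "y \<in> {(s ^^ i) p | i. i < k}"
    then obtain i where i: "y = (s ^^ i) p" "i < k" by auto
    have sy: "s y = (s ^^ Suc i) p" using i by simp
    show "?t y \<in> {(s ^^ i) p | i. i < k}"
    proof (cases "Suc i = k")
      case True
      then have "?t y = p" using sy k by simp
      then show ?thesis using k0 by (auto intro!: exI[of _ 0])
    next
      case False
      then have "Suc i < k" using i by auto
      then have "?t y = (s ^^ Suc i) p" using sy kmin[of "Suc i"] np[of "Suc i"] by (auto simp: Transposition.transpose_def)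
      then show ?thesis using \<open>Suc i < k\<close> by blast
    qed
  qed
  then show ?thesis using kmin by auto
qed

text \<open>Splitting is merging run backwards: a second multiplication by the same transposition
  restores \<open>s\<close>.\<close>

lemma card_orbits_transpose_split:
  assumes s: "s permutes S" "finite S" and pq: "p \<in> S" "q \<in> S" "q \<in> orbit s p" "p \<noteq> q"
  shows "card (orbit (Transposition.transpose p q \<circ> s) ` S) = Suc (card (orbit s ` S))"
proof -
  let ?t = "Transposition.transpose p q \<circ> s"
  have ps: "permutation s" using s by (metis permutation_permutes)
  have t: "?t permutes S" using s pq by (intro permutes_compose permutes_swap_id)
  have "Transposition.transpose p q \<circ> ?t = s" by (simp add: comp_assoc[symmetric] del: comp_apply)
  then show ?thesis
    using card_orbits_transpose_merge[OF t s(2) pq(1,2) orbit_transpose_split[OF ps pq(3,4)]] by simp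
qed

lemma num_cycles_merge:
  assumes "s permutes {1..n}" "p \<in> {1..n}" "q \<in> {1..n}" "q \<notin> orbit s p"
  shows "Suc (num_cycles n (Transposition.transpose p q \<circ> s)) = num_cycles n s"
  using card_orbits_transpose_merge[OF assms(1) _ assms(2-)] by (simp add: num_cycles_def)

lemma num_cycles_split:
  assumes "s permutes {1..n}" "p \<in> {1..n}" "q \<in> {1..n}" "q \<in> orbit s p" "p \<noteq> q"
  shows "num_cycles n (Transposition.transpose p q \<circ> s) = Suc (num_cycles n s)"
  using card_orbits_transpose_split[OF assms(1) _ assms(2-)] by (simp add: num_cycles_def)

lemma num_cycles_Suc:
  assumes "s permutes {1..n}"
  shows "num_cycles (Suc n) s = Suc (num_cycles n s)"
proof -
  have "s (Suc n) = Suc n" using assms by (auto simp: permutes_def)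
  then have o: "orbit s (Suc n) = {Suc n}" by (simp add: orbit_eq_singleton_iff)
  have "orbit s ` {1..Suc n} = insert {Suc n} (orbit s ` {1..n})"
    using o by (simp add: atLeastAtMostSuc_conv del: One_nat_def)
  moreover have "{Suc n} \<notin> orbit s ` {1..n}"
  proof
    assume "{Suc n} \<in> orbit s ` {1..n}"
    then obtain x where "x \<in> {1..n}" "{Suc n} = orbit s x" by auto
    then have "x \<in> {1..n}" "Suc n \<in> orbit s x" by (blast, blast)
    then show False using permutes_orbit_subset[OF assms] by fastforce
  qed
  ultimately show ?thesis unfolding num_cycles_def by simp
qed

lemma num_cycles_conj:
  assumes "bij p" "p ` {1..n} = {1..n}" "permutation s"
  shows "num_cycles n (p \<circ> s \<circ> Hilbert_Choice.inv p) = num_cycles n s"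
proof -
  have o: "orbit (p \<circ> s \<circ> Hilbert_Choice.inv p) (p x) = p ` orbit s x" for x
    using assms(1,3)
    by (intro orbit_inverse[symmetric]) (auto simp: bij_def permutation_self_in_orbit)
  have "orbit (p \<circ> s \<circ> Hilbert_Choice.inv p) ` {1..n} = orbit (p \<circ> s \<circ> Hilbert_Choice.inv p) ` p ` {1..n}" using assms by simp
  also have "\<dots> = (`) p ` orbit s ` {1..n}" unfolding image_image o ..
  finally show ?thesis unfolding num_cycles_def
    using assms(1) by (simp add: card_image inj_on_def bij_def inj_image_eq_iff)
qed

section \<open>The genus bound and its equality case\<close>

text \<open>This is \<gamma>. For \<open>n = 0\<close> it is the identity, so that inductions on
  \<open>n\<close> can start there.\<close>

definition long_cycle :: "nat \<Rightarrow> nat \<Rightarrow> nat" where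
  "long_cycle n x = (if 1 \<le> x \<and> x < n then Suc x else if x = n \<and> 1 \<le> n then 1 else x)"

text \<open>This is the inverse of the Kreweras complement \<open>a\<^sup>-\<^sup>1\<gamma>\<close>, so it has the same number of cycles.\<close>

definition kreweras :: "nat \<Rightarrow> (nat \<Rightarrow> nat) \<Rightarrow> nat \<Rightarrow> nat" where
  "kreweras n a = Hilbert_Choice.inv (long_cycle n) \<circ> a"

text \<open>The equivalence is demanded at every point of the type, so complements and intersections
  of stable sets are stable. The arguments below cut stable intervals out of one another in this
  way.\<close>

definition stable :: "('a \<Rightarrow> 'a) \<Rightarrow> 'a set \<Rightarrow> bool" where
  "stable a I \<longleftrightarrow> (\<forall>y. a y \<in> I \<longleftrightarrow> y \<in> I)"

text \<open>For the permutation of a partition, \<open>x < a x\<close> means that \<open>a x\<close>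
  is the next element of the block of \<open>x\<close>; otherwise \<open>x\<close> is the maximum of
  its block and \<open>a x\<close> the minimum. The two clauses thus concern the gaps inside a block
  and the hull of a block.\<close>

definition nested :: "nat \<Rightarrow> (nat \<Rightarrow> nat) \<Rightarrow> bool" where
  "nested n a \<longleftrightarrow> (\<forall>x\<in>{1..n}. (x < a x \<longrightarrow> stable a {x<..<a x}) \<and> (a x \<le> x \<longrightarrow> stable a {a x..x}))"

section \<open>The long cycle and the insertion of a new largest point\<close>

lemma long_cycle_Suc: "long_cycle (Suc n) = Transposition.transpose 1 (Suc n) \<circ> long_cycle n"
  by (rule ext) (auto simp: long_cycle_def Transposition.transpose_def)

lemma long_cycle_permutes: "long_cycle n permutes {1..n}"
proof (induction n)
  case 0
  have "long_cycle 0 = id" by (auto simp: long_cycle_def)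
  then show ?case using permutes_id by metis
next
  case (Suc n)
  have "long_cycle n permutes {1..Suc n}" by (rule permutes_subset[OF Suc]) auto
  then show ?case unfolding long_cycle_Suc by (intro permutes_compose permutes_swap_id) auto
qed

lemma bij_long_cycle: "bij (long_cycle n)"
  using long_cycle_permutes permutes_bij by blast

lemma inv_long_cycle: "Hilbert_Choice.inv (long_cycle n) m = (if m = 1 \<and> 1 \<le> n then n else if 1 < m \<and> m \<le> n then m - 1 else m)"
  by (rule inv_f_eq[OF bij_is_inj[OF bij_long_cycle]]) (auto simp: long_cycle_def)

lemma kreweras_permutes: "a permutes {1..n} \<Longrightarrow> kreweras n a permutes {1..n}"
  unfolding kreweras_def by (intro permutes_compose permutes_inv long_cycle_permutes)

lemma kreweras_apply:
  assumes "a permutes {1..n}" "y \<in> {1..n}"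
  shows "kreweras n a y = (if a y = 1 then n else a y - 1)"
proof -
  have "a y \<in> {1..n}" using assms by (simp only: permutes_in_image)
  then show ?thesis using assms(2) unfolding kreweras_def by (auto simp: inv_long_cycle)
qed

lemma permutation_of_permutes_nat: "(a :: nat \<Rightarrow> nat) permutes {1..n} \<Longrightarrow> permutation a"
  using permutation_permutes by blast

lemma long_cycle_kreweras: "long_cycle n \<circ> kreweras n a = a"
  unfolding kreweras_def by (simp add: fun_eq_iff surj_f_inv_f[OF bij_is_surj[OF bij_long_cycle]])

text \<open>The long cycle on \<open>Suc n\<close> points is
  \<open>transpose 1 (Suc n) \<circ> long_cycle n\<close>. A transposition moves past
  \<open>long_cycle n\<close> by conjugation, which fixes \<open>Suc n\<close> and takes
  \<open>m\<close> to its predecessor, in particular 1 to \<open>n\<close>. So one insertion into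
  \<open>a\<close> costs two transpositions in the complement.\<close>

lemma kreweras_Suc_transpose:
  assumes "m \<in> {1..n}"
  shows "kreweras (Suc n) (Transposition.transpose m (Suc n) \<circ> a) =
    Transposition.transpose n (Suc n) \<circ> (Transposition.transpose (Hilbert_Choice.inv (long_cycle n) m) (Suc n) \<circ> kreweras n a)"
proof -
  have i: "Hilbert_Choice.inv (long_cycle (Suc n)) = Hilbert_Choice.inv (long_cycle n) \<circ> Transposition.transpose 1 (Suc n)"
    unfolding long_cycle_Suc by (subst o_inv_distrib[OF _ bij_long_cycle]) auto
  have t: "Transposition.transpose b (Suc n) \<circ> long_cycle n =
      long_cycle n \<circ> Transposition.transpose (Hilbert_Choice.inv (long_cycle n) b) (Suc n)" for b
    using transpose_comp_eq[OF bij_long_cycle, of b "Suc n" n] by (simp add: inv_long_cycle)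
  have "long_cycle n \<circ> kreweras (Suc n) (Transposition.transpose m (Suc n) \<circ> a) =
     Transposition.transpose 1 (Suc n) \<circ> (Transposition.transpose m (Suc n) \<circ> a)"
    unfolding kreweras_def i by (simp add: fun_eq_iff surj_f_inv_f[OF bij_is_surj[OF bij_long_cycle]])
  also have "\<dots> = Transposition.transpose 1 (Suc n) \<circ> ((Transposition.transpose m (Suc n) \<circ> long_cycle n) \<circ> kreweras n a)"
    by (simp add: comp_assoc long_cycle_kreweras)
  also have "\<dots> = (Transposition.transpose 1 (Suc n) \<circ> long_cycle n) \<circ>
      (Transposition.transpose (Hilbert_Choice.inv (long_cycle n) m) (Suc n) \<circ> kreweras n a)"
    unfolding t[of m] by (simp add: comp_assoc)
  also have "\<dots> = long_cycle n \<circ> (Transposition.transpose n (Suc n) \<circ>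
      (Transposition.transpose (Hilbert_Choice.inv (long_cycle n) m) (Suc n) \<circ> kreweras n a))"
    using assms unfolding t[of 1] by (simp add: comp_assoc inv_long_cycle)
  finally show ?thesis using bij_is_inj[OF bij_long_cycle, of n] by (simp add: fun_eq_iff inj_eq)
qed

lemma kreweras_Suc_fix:
  assumes "n \<ge> 1"
  shows "kreweras (Suc n) a = Transposition.transpose n (Suc n) \<circ> kreweras n a"
proof -
  \<comment> \<open>The previous lemma is applied with \<open>m = 1\<close> to
    \<open>transpose 1 (Suc n) \<circ> a\<close>. The predecessor of 1 is \<open>n\<close>, so both
    transpositions on the right are the same and cancel.\<close>
  have "kreweras (Suc n) (Transposition.transpose 1 (Suc n) \<circ> (Transposition.transpose 1 (Suc n) \<circ> a)) =
    Transposition.transpose n (Suc n) \<circ> (Transposition.transpose n (Suc n) \<circ> 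
       kreweras n (Transposition.transpose 1 (Suc n) \<circ> a))"
    using kreweras_Suc_transpose[of 1 n "Transposition.transpose 1 (Suc n) \<circ> a"] assms by (simp add: inv_long_cycle)
  then have *: "kreweras (Suc n) a = kreweras n (Transposition.transpose 1 (Suc n) \<circ> a)"
    by (simp add: comp_assoc[symmetric] del: comp_apply)
  have "long_cycle n \<circ> kreweras (Suc n) a = long_cycle n \<circ> (Transposition.transpose n (Suc n) \<circ> kreweras n a)"
  proof -
    have "Transposition.transpose 1 (Suc n) \<circ> long_cycle n = long_cycle n \<circ> Transposition.transpose n (Suc n)"
      using transpose_comp_eq[OF bij_long_cycle, of 1 "Suc n" n] assms by (simp add: inv_long_cycle)
    then show ?thesis unfolding * long_cycle_kreweras by (metis comp_assoc long_cycle_kreweras)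
  qed
  then show ?thesis using bij_is_inj[OF bij_long_cycle, of n] by (simp add: fun_eq_iff inj_eq)
qed

lemma Suc_notin_orbit:
  assumes "a permutes {1..n}" "m \<in> {1..n}"
  shows "Suc n \<notin> orbit a m"
  using permutes_orbit_subset[OF assms] by auto

lemma permutes_Suc: "a permutes {1..n} \<Longrightarrow> a permutes {1..Suc n}"
  by (erule permutes_subset) auto

text \<open>\<open>Suc n\<close> starts as a fixed point, which is one extra cycle, and is then
  merged into the cycle of \<open>m\<close>.\<close>

lemma num_cycles_insert:
  assumes "a permutes {1..n}" "m \<in> {1..n}"
  shows "num_cycles (Suc n) (Transposition.transpose m (Suc n) \<circ> a) = num_cycles n a"
  using num_cycles_merge[OF permutes_Suc[OF assms(1)], of m "Suc n"] assms
    Suc_notin_orbit[OF assms] num_cycles_Suc[OF assms(1)] by simp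

text \<open>Of the two transpositions acting on the complement, the first attaches
  \<open>Suc n\<close> to the cycle of the predecessor of \<open>m\<close> and leaves the count as
  it was. The second exchanges \<open>n\<close> and \<open>Suc n\<close>: it splits a cycle if the
  predecessor of \<open>m\<close> lies on the cycle of \<open>n\<close>, and merges two cycles
  otherwise.\<close>

lemma num_cycles_kreweras_insert:
  assumes a: "a permutes {1..n}" and m: "m \<in> {1..n}"
  defines "b \<equiv> Transposition.transpose m (Suc n) \<circ> a"
  shows "if Hilbert_Choice.inv (long_cycle n) m \<in> orbit (kreweras n a) n
    then num_cycles (Suc n) (kreweras (Suc n) b) = Suc (num_cycles n (kreweras n a))
    else Suc (num_cycles (Suc n) (kreweras (Suc n) b)) = num_cycles n (kreweras n a)"
proof -
  let ?m = "Hilbert_Choice.inv (long_cycle n) m" and ?K = "kreweras n a"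
  have K: "?K permutes {1..n}" by (rule kreweras_permutes[OF a])
  note pK = permutation_of_permutes_nat[OF K]
  have mm: "?m \<in> {1..n}" and n: "n \<in> {1..n}" using m by (auto simp: inv_long_cycle)
  show ?thesis
  proof (cases "?m = n")
    case True
    \<comment> \<open>The two transpositions coincide and cancel, so \<open>Suc n\<close> is a fixed
      point of the new complement and supplies the additional cycle.\<close>
    have "kreweras (Suc n) b = ?K"
      unfolding b_def kreweras_Suc_transpose[OF m] True by (simp add: comp_assoc[symmetric] del: comp_apply)
    then show ?thesis using True num_cycles_Suc[OF K] permutation_self_in_orbit[OF pK] by simp
  next
    case False
    let ?r = "Transposition.transpose ?m (Suc n) \<circ> ?K"
    have r: "?r permutes {1..Suc n}" using mm
      by (intro permutes_compose permutes_swap_id permutes_Suc[OF K]) auto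
    note pr = permutation_of_permutes_nat[OF r]
    have rc: "num_cycles (Suc n) ?r = num_cycles n ?K" by (rule num_cycles_insert[OF K mm])
    have o: "orbit ?r (Suc n) = orbit ?K ?m \<union> orbit ?K (Suc n)"
      by (rule orbit_transpose_merge(2)[OF pK Suc_notin_orbit[OF K mm]])
    have "?K (Suc n) = Suc n" using K by (auto simp: permutes_def)
    then have o1: "orbit ?K (Suc n) = {Suc n}" by (simp add: orbit_eq_singleton_iff)
    have "Suc n \<in> orbit ?r n \<longleftrightarrow> n \<in> orbit ?r (Suc n)"
      using orbit_eq_if_mem[OF pr] permutation_self_in_orbit[OF pr] by metis
    also have "\<dots> \<longleftrightarrow> n \<in> orbit ?K ?m" unfolding o o1 by auto
    also have "\<dots> \<longleftrightarrow> ?m \<in> orbit ?K n"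
      using orbit_eq_if_mem[OF pK] permutation_self_in_orbit[OF pK] by metis
    finally have *: "Suc n \<in> orbit ?r n \<longleftrightarrow> ?m \<in> orbit ?K n" .
    have b: "kreweras (Suc n) b = Transposition.transpose n (Suc n) \<circ> ?r"
      unfolding b_def kreweras_Suc_transpose[OF m] ..
    show ?thesis
    proof (cases "?m \<in> orbit ?K n")
      case True
      then show ?thesis unfolding b using num_cycles_split[OF r, of n "Suc n"] * n rc by simp
    next
      case False
      then show ?thesis unfolding b using num_cycles_merge[OF r, of n "Suc n"] * n rc by simp
    qed
  qed
qed

lemma num_cycles_kreweras_fix:
  assumes a: "a permutes {1..n}" and n: "n \<ge> 1"
  shows "num_cycles (Suc n) (kreweras (Suc n) a) = num_cycles n (kreweras n a)"
  unfolding kreweras_Suc_fix[OF n] using n by (intro num_cycles_insert kreweras_permutes[OF a]) auto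

section \<open>Nestedness under insertion, and the genus bound\<close>

lemma stable_all: "a permutes {1..n} \<Longrightarrow> stable a {1..n}"
  unfolding stable_def by (simp only: permutes_in_image) simp

text \<open>The orbit of \<open>n\<close> under the complement walks leftwards over the outermost
  blocks: it consists of the \<open>j\<close> for which the tail \<open>{Suc j..n}\<close> is
  stable. The claim is this description read at the predecessor of \<open>m\<close>.\<close>

lemma nested_orbit_kreweras:
  assumes a: "a permutes {1..n}" and n: "n \<ge> 1" and Q: "nested n a" and m: "m \<in> {1..n}"
  shows "Hilbert_Choice.inv (long_cycle n) m \<in> orbit (kreweras n a) n \<longleftrightarrow> stable a {m..n}"
proof -
  note ain = permutes_in_image[OF a]
  have all: "stable a {1..n}" by (rule stable_all[OF a])
  have down: "stable a {a x..x}" if "x \<in> {1..n}" "a x \<le> x" for x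
    using Q that unfolding nested_def by auto
  have pK: "permutation (kreweras n a)" by (rule permutation_of_permutes_nat[OF kreweras_permutes[OF a]])
  have emp: "stable a {Suc n..n}" by (auto simp: stable_def)
  \<comment> \<open>If the tail after \<open>j\<close> is stable, \<open>j\<close> cannot be sent
    into it, so \<open>a j \<le> j\<close> and the hull \<open>{a j..j}\<close> is stable. Adjoining
    it to the tail gives the tail after \<open>a j - 1\<close>, the next point of the walk. If
    \<open>a j = 1\<close>, the walk wraps around to \<open>n\<close>, whose tail is empty.\<close>
  have sub: "orbit (kreweras n a) n \<subseteq> {j\<in>{1..n}. stable a {Suc j..n}}"
  proof (rule orbit_least)
    show "n \<in> {j\<in>{1..n}. stable a {Suc j..n}}" using n emp by auto
    fix j assume "j \<in> {j\<in>{1..n}. stable a {Suc j..n}}"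
    then have j: "j \<in> {1..n}" and s: "stable a {Suc j..n}" by auto
    have aj: "a j \<in> {1..n}" using ain j by simp
    moreover have "a j \<in> {Suc j..n} \<longleftrightarrow> j \<in> {Suc j..n}" using s unfolding stable_def ..
    ultimately have "a j \<le> j" by auto
    then have d: "stable a {a j..j}" using down j by simp
    have "stable a {a j..n}"
      unfolding stable_def
    proof
      fix y
      have "y \<in> {a j..n} \<longleftrightarrow> y \<in> {a j..j} \<or> y \<in> {Suc j..n}" for y using j \<open>a j \<le> j\<close> by auto
      then show "a y \<in> {a j..n} \<longleftrightarrow> y \<in> {a j..n}" using d s unfolding stable_def by blast
    qed
    moreover have "kreweras n a j = (if a j = 1 then n else a j - 1)" by (rule kreweras_apply[OF a j])
    ultimately show "kreweras n a j \<in> {j\<in>{1..n}. stable a {Suc j..n}}"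
      using aj n emp by (cases "a j = 1") auto
  qed
  \<comment> \<open>Conversely, the preimage \<open>x\<close> of \<open>Suc j\<close> lies in the
    tail, so \<open>{Suc j..x}\<close> is stable. Removing it leaves the shorter stable tail after
    \<open>x\<close>, and the walk goes from \<open>x\<close> to \<open>a x - 1 = j\<close>.\<close>
  have sup: "j \<in> orbit (kreweras n a) n" if "j \<in> {1..n}" "stable a {Suc j..n}" for j
    using that
  proof (induction "n - j" arbitrary: j rule: less_induct)
    case less
    show ?case
    proof (cases "j = n")
      case True
      then show ?thesis using permutation_self_in_orbit[OF pK] by simp
    next
      case False
      then have j: "Suc j \<in> {1..n}" "1 \<le> j" using less.prems by auto
      obtain x where x: "a x = Suc j" using permutes_surj[OF a] by (metis surjD)
      have "a x \<in> {Suc j..n}" using x j by auto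
      then have xj: "x \<in> {Suc j..n}" using less.prems(2) unfolding stable_def by blast
      then have xn: "x \<in> {1..n}" "a x \<le> x" using x by auto
      then have d: "stable a {Suc j..x}" using down x by metis
      have "stable a {Suc x..n}"
        unfolding stable_def
      proof
        fix y
        have "y \<in> {Suc x..n} \<longleftrightarrow> y \<in> {Suc j..n} \<and> y \<notin> {Suc j..x}" for y using xj by auto
        then show "a y \<in> {Suc x..n} \<longleftrightarrow> y \<in> {Suc x..n}"
          using d less.prems(2) unfolding stable_def by blast
      qed
      then have "x \<in> orbit (kreweras n a) n" using xj xn by (intro less.hyps) auto
      then have "kreweras n a x \<in> orbit (kreweras n a) n" by (rule orbit.step)
      moreover have "kreweras n a x = j" using kreweras_apply[OF a xn(1)] x j by simp
      ultimately show ?thesis by simp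
    qed
  qed
  let ?m = "Hilbert_Choice.inv (long_cycle n) m"
  have mm: "?m \<in> {1..n}" using m n by (auto simp: inv_long_cycle)
  have "?m \<in> orbit (kreweras n a) n \<longleftrightarrow> stable a {Suc ?m..n}" using sub sup mm by blast
  also have "\<dots> \<longleftrightarrow> stable a {m..n}"
  \<comment> \<open>The predecessor of 1 is \<open>n\<close>, so the tail on the left is empty while
    \<open>{m..n}\<close> is everything; both are stable.\<close>
  proof (cases "m = 1")
    case True
    then show ?thesis using all n emp by (simp add: inv_long_cycle)
  next
    case False
    then show ?thesis using m by (simp add: inv_long_cycle)
  qed
  finally show ?thesis .
qed

lemma nested_fix:
  assumes a: "a permutes {1..n}"
  shows "nested (Suc n) a \<longleftrightarrow> nested n a"
proof -
  have f: "a (Suc n) = Suc n" using a by (auto simp: permutes_def)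
  have "stable a {Suc n}" unfolding stable_def using f permutes_inj[OF a] by (metis injD singleton_iff)
  then show ?thesis unfolding nested_def using f by (simp add: atLeastAtMostSuc_conv)
qed

text \<open>With \<open>a p = m\<close>, the new permutation reads \<open>p\<close>,
  \<open>Suc n\<close>, \<open>m\<close> where \<open>a\<close> reads \<open>p\<close>,
  \<open>m\<close>. The condition of \<open>b\<close> at \<open>Suc n\<close> amounts to stability
  of \<open>{m..n}\<close>. At \<open>p\<close>, a gap up to \<open>Suc n\<close> takes the place of
  the hull \<open>{m..p}\<close>, and these are complementary in \<open>{m..n}\<close>. At all other
  points the conditions for \<open>a\<close> and \<open>b\<close> agree.\<close>

lemma nested_insert:
  assumes a: "a permutes {1..n}" and m: "m \<in> {1..n}"
  defines "b \<equiv> Transposition.transpose m (Suc n) \<circ> a"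
  shows "nested (Suc n) b \<longleftrightarrow> nested n a \<and> stable a {m..n}"
proof -
  note ain = permutes_in_image[OF a]
  have inj: "a x = a y \<longleftrightarrow> x = y" for x y using permutes_inj[OF a] by (auto dest: injD)
  obtain p where p: "a p = m" using permutes_surj[OF a] by (metis surjD)
  have pn: "p \<in> {1..n}" using p m ain by metis
  have fx: "a (Suc n) = Suc n" using a by (auto simp: permutes_def)
  have b_new: "b (Suc n) = m" unfolding b_def using fx by simp
  have b_p: "b p = Suc n" unfolding b_def using p by simp
  have b_eq: "b x = a x" if "x \<noteq> p" "x \<noteq> Suc n" for x
    unfolding b_def using that inj[of x p] inj[of x "Suc n"] p fx by (simp add: Transposition.transpose_def)
  have b_perm: "b permutes {1..Suc n}" unfolding b_def using m
    by (intro permutes_compose permutes_swap_id permutes_Suc[OF a]) auto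
  \<comment> \<open>A set that avoids the three rewired points cannot tell \<open>a\<close> from
    \<open>b\<close>.\<close>
  have same: "stable a I \<longleftrightarrow> stable b I" if "p \<notin> I" "Suc n \<notin> I" "m \<notin> I" for I
    unfolding stable_def using b_eq b_p b_new p fx that by metis
  have up: "stable a {m..n} \<longleftrightarrow> stable b {m..Suc n}"
  proof
    assume s: "stable a {m..n}"
    have pm: "p \<in> {m..n}" using s p m unfolding stable_def by (metis atLeastAtMost_iff order_refl)
    show "stable b {m..Suc n}" unfolding stable_def
    proof
      fix y show "b y \<in> {m..Suc n} \<longleftrightarrow> y \<in> {m..Suc n}"
      proof (cases "y = p \<or> y = Suc n")
        case True
        then show ?thesis using b_p b_new pm m by auto
      next
        case False
        then have "a y \<noteq> Suc n" using inj fx by metis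
        then show ?thesis using False b_eq[of y] s unfolding stable_def
          by (metis atLeastAtMost_iff le_Suc_eq)
      qed
    qed
  next
    assume s: "stable b {m..Suc n}"
    have pm: "p \<in> {m..Suc n}" using s b_p m unfolding stable_def by (metis atLeastAtMost_iff order_refl le_SucI)
    show "stable a {m..n}" unfolding stable_def
    proof
      fix y show "a y \<in> {m..n} \<longleftrightarrow> y \<in> {m..n}"
      proof (cases "y = p \<or> y = Suc n")
        case True
        then show ?thesis using p fx pm m pn by auto
      next
        case False
        then have "a y \<noteq> Suc n" using inj fx by metis
        then show ?thesis using False b_eq[of y] s unfolding stable_def
          by (metis atLeastAtMost_iff le_Suc_eq)
      qed
    qed
  qed
  show ?thesis
  proof
    assume Q: "nested (Suc n) b"
    have "stable b {m..Suc n}" using Q b_new m unfolding nested_def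
      by (metis atLeastAtMost_iff le_SucI le_refl One_nat_def Suc_le_mono zero_le)
    then have s: "stable a {m..n}" using up by simp
    then have pm: "p \<in> {m..n}" using p m unfolding stable_def by (metis atLeastAtMost_iff order_refl)
    have sp: "stable b {p<..<Suc n}" using Q b_p pn unfolding nested_def by (metis atLeastAtMost_iff le_SucI less_Suc_eq_le)
    have "(x < a x \<longrightarrow> stable a {x<..<a x}) \<and> (a x \<le> x \<longrightarrow> stable a {a x..x})" if x: "x \<in> {1..n}" for x
    proof (cases "x = p")
      case True
      have "stable a {p<..<Suc n}" using sp pm by (subst same) auto
      \<comment> \<open>The hull required by \<open>a\<close> at \<open>p\<close> is what remains of
        \<open>{m..n}\<close> after removing the gap that \<open>b\<close> provides.\<close>
      moreover have "y \<in> {m..p} \<longleftrightarrow> y \<in> {m..n} \<and> y \<notin> {p<..<Suc n}" for y using pm by auto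
      ultimately have "stable a {m..p}" using s unfolding stable_def by blast
      then show ?thesis using True p pm by auto
    next
      case False
      have bx: "b x = a x" using False x by (intro b_eq) auto
      have ax: "a x \<in> {1..n}" using ain x by simp
      \<comment> \<open>A set stable under \<open>b\<close> that misses \<open>Suc n\<close> also
        misses its neighbours \<open>p\<close> and \<open>m\<close> on the cycle.\<close>
      have *: "stable a I" if "stable b I" "Suc n \<notin> I" for I
      proof -
        have "p \<notin> I" using that b_p unfolding stable_def by metis
        moreover have "m \<notin> I" using that b_new unfolding stable_def by metis
        ultimately show ?thesis using same that by simp
      qed
      have "(x < b x \<longrightarrow> stable b {x<..<b x}) \<and> (b x \<le> x \<longrightarrow> stable b {b x..x})"
        using Q x unfolding nested_def by auto
      then show ?thesis unfolding bx using x ax by (auto intro!: *)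
    qed
    then show "nested n a \<and> stable a {m..n}" using s unfolding nested_def by blast
  next
    assume "nested n a \<and> stable a {m..n}"
    then have Q: "nested n a" and s: "stable a {m..n}" by auto
    have pm: "p \<in> {m..n}" using s p m unfolding stable_def by (metis atLeastAtMost_iff order_refl)
    have "(x < b x \<longrightarrow> stable b {x<..<b x}) \<and> (b x \<le> x \<longrightarrow> stable b {b x..x})" if x: "x \<in> {1..Suc n}" for x
    proof -
      consider "x = Suc n" | "x = p" | "x \<in> {1..n}" "x \<noteq> p" "x \<noteq> Suc n" using x by fastforce
      then show ?thesis
      proof cases
        case 1
        then show ?thesis using b_new m up s by auto
      next
        case 2
        have "stable a {m..p}" using Q pn p pm unfolding nested_def by (metis atLeastAtMost_iff)
        moreover have "y \<in> {p<..<Suc n} \<longleftrightarrow> y \<in> {m..n} \<and> y \<notin> {m..p}" for y using pm by auto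
        ultimately have "stable a {p<..<Suc n}" using s unfolding stable_def by blast
        then have "stable b {p<..<Suc n}" using pm by (subst same[symmetric]) auto
        then show ?thesis using 2 b_p pn by auto
      next
        case 3
        have bx: "b x = a x" using 3 by (intro b_eq) auto
        have ax: "a x \<in> {1..n}" using ain 3 by simp
        have sx: "a x \<in> {m..n} \<longleftrightarrow> x \<in> {m..n}" using s unfolding stable_def by simp
        have nm: "a x \<noteq> m" using inj[of x p] p 3 by auto
        have *: "stable b I" if "stable a I" "p \<notin> I" "Suc n \<notin> I" for I
        proof -
          have "m \<notin> I" using that p unfolding stable_def by metis
          then show ?thesis using same that by simp
        qed
        have c: "(x < a x \<longrightarrow> stable a {x<..<a x}) \<and> (a x \<le> x \<longrightarrow> stable a {a x..x})"
          using Q 3 unfolding nested_def by auto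
        show ?thesis unfolding bx
        proof (intro conjI impI)
          assume l: "x < a x"
          then have c': "stable a {x<..<a x}" using c by simp
          \<comment> \<open>If \<open>p\<close> were in the gap, so would be its image
            \<open>m\<close>; then \<open>x\<close> would lie outside the stable set
            \<open>{m..n}\<close> and \<open>a x\<close> inside it.\<close>
          have "p \<notin> {x<..<a x}"
          proof
            assume "p \<in> {x<..<a x}"
            then have "m \<in> {x<..<a x}" using c' p unfolding stable_def by metis
            then have "x < m" "a x \<ge> m" by auto
            then show False using sx ax by auto
          qed
          then show "stable b {x<..<a x}" using ax by (intro *[OF c']) auto
        next
          assume l: "a x \<le> x"
          then have c': "stable a {a x..x}" using c by simp
          \<comment> \<open>Here \<open>m\<close> in the hull would put \<open>x\<close> into
            \<open>{m..n}\<close>, while \<open>a x\<close> differs from \<open>m\<close> and so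
            would lie strictly below it.\<close>
          have "p \<notin> {a x..x}"
          proof
            assume "p \<in> {a x..x}"
            then have "m \<in> {a x..x}" using c' p unfolding stable_def by metis
            then have "x \<in> {m..n}" "a x \<le> m" using 3 by auto
            then show False using sx nm by auto
          qed
          then show "stable b {a x..x}" using 3 by (intro *[OF c']) auto
        qed
      qed
    qed
    then show "nested (Suc n) b" unfolding nested_def by blast
  qed
qed

text \<open>From \<open>n\<close> to \<open>Suc n\<close> the bound grows by one. If
  \<open>Suc n\<close> is fixed, \<open>a\<close> gains a cycle and the complement none. Otherwise
  \<open>a\<close> gains none and the complement gains or loses one; a gain keeps the distance to
  the bound, a loss makes the inequality strict.\<close>

lemma genus_bound:
  assumes "n \<ge> 1" "a permutes {1..n}"
  shows "num_cycles n a + num_cycles n (kreweras n a) \<le> Suc n \<and>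
    (num_cycles n a + num_cycles n (kreweras n a) = Suc n \<longleftrightarrow> nested n a)"
  using assms
proof (induction n arbitrary: a rule: dec_induct)
  case base
  have a: "a = id" using base by (auto simp: permutes_sing)
  have g: "kreweras 1 a = id" unfolding kreweras_def a by (rule ext) (simp add: inv_long_cycle)
  show ?case unfolding g unfolding a nested_def stable_def num_cycles_def by simp
next
  case (step n)
  show ?case
  proof (cases "a (Suc n) = Suc n")
    case True
    have a: "a permutes {1..n}" by (rule permutes_superset[OF step.prems]) (use True in \<open>auto simp: le_Suc_eq\<close>)
    show ?thesis using step.IH[OF a] num_cycles_Suc[OF a] num_cycles_kreweras_fix[OF a step.hyps(1)] nested_fix[OF a]
      by simp
  next
    case False
    define m where "m = a (Suc n)"
    define b where "b = Transposition.transpose m (Suc n) \<circ> a"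
    have "m \<in> {1..Suc n}" unfolding m_def using step.prems by (simp only: permutes_in_image) simp
    then have m: "m \<in> {1..n}" using False m_def by (auto simp: le_Suc_eq)
    have "b permutes {1..Suc n}" unfolding b_def
      using m by (intro permutes_compose[OF step.prems] permutes_swap_id) auto
    then have b: "b permutes {1..n}"
      by (rule permutes_superset) (auto simp: le_Suc_eq b_def m_def)
    have ab: "a = Transposition.transpose m (Suc n) \<circ> b"
      unfolding b_def by (simp add: comp_assoc[symmetric] del: comp_apply)
    note IH = step.IH[OF b]
    have 1: "num_cycles (Suc n) a = num_cycles n b"
      unfolding ab by (rule num_cycles_insert[OF b m])
    have 2: "if Hilbert_Choice.inv (long_cycle n) m \<in> orbit (kreweras n b) n
      then num_cycles (Suc n) (kreweras (Suc n) a) = Suc (num_cycles n (kreweras n b))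
      else Suc (num_cycles (Suc n) (kreweras (Suc n) a)) = num_cycles n (kreweras n b)"
      unfolding ab by (rule num_cycles_kreweras_insert[OF b m])
    have 3: "nested (Suc n) a \<longleftrightarrow> nested n b \<and> stable b {m..n}"
      unfolding ab by (rule nested_insert[OF b m])
    have 4: "nested n b \<Longrightarrow> Hilbert_Choice.inv (long_cycle n) m \<in> orbit (kreweras n b) n \<longleftrightarrow> stable b {m..n}"
      by (rule nested_orbit_kreweras[OF b step.hyps(1) _ m])
    show ?thesis
    proof (cases "Hilbert_Choice.inv (long_cycle n) m \<in> orbit (kreweras n b) n")
      case True
      then show ?thesis using 1 2 3 4 IH by auto
    next
      \<comment> \<open>The sum drops while the bound rises, so equality fails. Nestedness fails as
        well: either \<open>b\<close> is not nested, or \<open>{m..n}\<close> is not stable.\<close>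
      case False
      then show ?thesis using 1 2 3 4 IH by auto
    qed
  qed
qed

section \<open>Non-crossing partitions\<close>

lemma stable_orbit: "stable a I \<Longrightarrow> x \<in> I \<Longrightarrow> orbit a x \<subseteq> I"
  by (rule orbit_least) (auto simp: stable_def)

lemma cycle_of_list_funpow_nth:
  assumes "distinct xs" "i < length xs"
  shows "(cycle_of_list xs ^^ k) (xs ! i) = xs ! ((k + i) mod length xs)"
proof -
  have "(cycle_of_list xs ^^ k) (xs ! i) = map (cycle_of_list xs ^^ k) xs ! i" using assms by simp
  also have "\<dots> = xs ! ((k + i) mod length xs)"
    unfolding cyclic_rotation[OF assms(1)] by (rule nth_rotate[OF assms(2)])
  finally show ?thesis .
qed

lemma cycle_of_sorted_list:
  fixes B :: "nat set"
  assumes "finite B" "x \<in> B"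
  defines "c \<equiv> cycle_of_list (sorted_list_of_set B)"
  shows "c x \<in> B" and "x < c x \<Longrightarrow> z \<in> B \<Longrightarrow> \<not> (x < z \<and> z < c x)"
    and "c x \<le> x \<Longrightarrow> B \<subseteq> {c x..x}" and "y \<in> B \<Longrightarrow> \<exists>k>0. y = (c ^^ k) x"
proof -
  define xs where "xs = sorted_list_of_set B"
  have xs: "distinct xs" "sorted_wrt (<) xs" "set xs = B" using assms(1) by (auto simp: xs_def)
  obtain i where i: "i < length xs" "x = xs ! i" using assms(2) xs(3) by (metis in_set_conv_nth)
  have c: "(c ^^ k) x = xs ! ((k + i) mod length xs)" for k
    unfolding c_def i(2) xs_def[symmetric] by (rule cycle_of_list_funpow_nth[OF xs(1) i(1)])
  have cx: "c x = xs ! (Suc i mod length xs)" using c[of 1] by simp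
  have lt: "xs ! j < xs ! k \<longleftrightarrow> j < k" if "j < length xs" "k < length xs" for j k
    using sorted_wrt_nth_less[OF xs(2), of j k] sorted_wrt_nth_less[OF xs(2), of k j] that
    by (metis linorder_neqE_nat order_less_asym' order_less_irrefl)
  have idx: "\<exists>j<length xs. z = xs ! j" if "z \<in> B" for z using that xs(3) by (metis in_set_conv_nth)
  show "c x \<in> B" unfolding cx using i(1) xs(3)
    by (metis nth_mem mod_less_divisor length_pos_if_in_set)
  show "\<not> (x < z \<and> z < c x)" if "x < c x" "z \<in> B"
  proof -
    obtain j where j: "j < length xs" "z = xs ! j" using idx \<open>z \<in> B\<close> by auto
    show ?thesis
    proof (cases "Suc i < length xs")
      case True
      then show ?thesis using lt[of i j] lt[of j "Suc i"] i j unfolding cx by auto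
    next
      case False
      then have "Suc i mod length xs = 0" using i(1) by (metis Suc_lessI mod_self)
      then show ?thesis using that(1) lt[of i 0] i unfolding cx by (metis length_pos_if_in_set nth_mem not_less0)
    qed
  qed
  show "B \<subseteq> {c x..x}" if le: "c x \<le> x"
  proof
    fix z assume "z \<in> B"
    then obtain j where j: "j < length xs" "z = xs ! j" using idx by auto
    show "z \<in> {c x..x}"
    proof (cases "Suc i < length xs")
      case True
      then show ?thesis using lt[of i "Suc i"] le i unfolding cx by auto
    next
      case False
      then have e: "Suc i = length xs" using i(1) by simp
      then have "Suc i mod length xs = 0" by simp
      then have "c x = xs ! 0" unfolding cx by simp
      moreover have "0 < length xs" using i(1) by linarith
      ultimately show ?thesis using lt[of j 0] lt[of i j] i j e by (auto simp: not_less[symmetric])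
    qed
  qed
  show "\<exists>k>0. y = (c ^^ k) x" if "y \<in> B"
  proof -
    obtain j where j: "j < length xs" "y = xs ! j" using idx \<open>y \<in> B\<close> by auto
    \<comment> \<open>Adding one full turn \<open>length xs\<close> makes the exponent positive even
      for \<open>j \<le> i\<close>.\<close>
    have "(c ^^ (j + length xs - i)) x = xs ! j"
      unfolding c using i j by simp
    then show ?thesis using i j by (intro exI[of _ "j + length xs - i"]) auto
  qed
qed

section \<open>From partitions to nested permutations\<close>

context
  fixes n :: nat and P :: "nat set set"
  assumes P: "partition_on {1..n} P"
begin

lemma partition_blockE:
  assumes "x \<in> {1..n}"
  obtains B where "B \<in> P" "x \<in> B"
  using partition_onD1[OF P] assms by auto

lemma partition_block_unique: "B \<in> P \<Longrightarrow> C \<in> P \<Longrightarrow> x \<in> B \<Longrightarrow> x \<in> C \<Longrightarrow> B = C"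
  using partition_onD2[OF P] by (auto simp: disjoint_def)

lemma partition_block_subset: "B \<in> P \<Longrightarrow> B \<subseteq> {1..n}"
  using partition_onD1[OF P] by auto

lemma perm_of_partition_block:
  assumes "B \<in> P" "x \<in> B"
  shows "perm_of_partition P x = cycle_of_list (sorted_list_of_set B) x"
proof -
  have "(THE C. C \<in> P \<and> x \<in> C) = B" using assms partition_block_unique by (intro the_equality) auto
  then show ?thesis using assms unfolding perm_of_partition_def by auto
qed

lemma finite_block: "B \<in> P \<Longrightarrow> finite B"
  using partition_block_subset finite_subset by (metis finite_atLeastAtMost)

lemma perm_of_partition_next:
  assumes B: "B \<in> P" "x \<in> B"
  shows "perm_of_partition P x \<in> B"
    and "x < perm_of_partition P x \<Longrightarrow> z \<in> B \<Longrightarrow> \<not> (x < z \<and> z < perm_of_partition P x)"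
    and "perm_of_partition P x \<le> x \<Longrightarrow> B \<subseteq> {perm_of_partition P x..x}"
  unfolding perm_of_partition_block[OF B]
  using cycle_of_sorted_list[OF finite_block[OF B(1)] B(2)] by blast+

lemma perm_of_partition_outside: "x \<notin> {1..n} \<Longrightarrow> perm_of_partition P x = x"
  using partition_onD1[OF P] unfolding perm_of_partition_def by auto

lemma orbit_perm_of_partition:
  assumes B: "B \<in> P" "x \<in> B"
  shows "orbit (perm_of_partition P) x = B"
proof
  show "orbit (perm_of_partition P) x \<subseteq> B"
    using B perm_of_partition_next(1) by (intro orbit_least) auto
  let ?c = "cycle_of_list (sorted_list_of_set B)"
  have *: "(perm_of_partition P ^^ k) x = (?c ^^ k) x \<and> (?c ^^ k) x \<in> B" for k
    using perm_of_partition_block[OF B(1)] cycle_of_sorted_list(1)[OF finite_block[OF B(1)]] B(2)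
    by (induction k) auto
  show "B \<subseteq> orbit (perm_of_partition P) x"
  proof
    fix y assume "y \<in> B"
    then obtain k where "k > 0" "y = (?c ^^ k) x"
      using cycle_of_sorted_list(4)[OF finite_block[OF B(1)] B(2)] by auto
    then show "y \<in> orbit (perm_of_partition P) x" unfolding orbit_altdef using * by auto
  qed
qed

lemma perm_of_partition_permutes: "perm_of_partition P permutes {1..n}"
proof (rule bij_imp_permutes)
  have im: "perm_of_partition P ` {1..n} \<subseteq> {1..n}"
  proof
    fix y assume "y \<in> perm_of_partition P ` {1..n}"
    then obtain x where x: "x \<in> {1..n}" "y = perm_of_partition P x" by auto
    obtain B where B: "B \<in> P" "x \<in> B" using partition_blockE[OF x(1)] .
    have "y \<in> B" using perm_of_partition_next(1)[OF B] x by simp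
    then show "y \<in> {1..n}" using partition_block_subset[OF B(1)] by auto
  qed
  have "inj_on (perm_of_partition P) {1..n}"
  proof (rule inj_onI)
    fix x y assume x: "x \<in> {1..n}" and y: "y \<in> {1..n}" and e: "perm_of_partition P x = perm_of_partition P y"
    obtain B where B: "B \<in> P" "x \<in> B" using partition_blockE[OF x] .
    obtain C where C: "C \<in> P" "y \<in> C" using partition_blockE[OF y] .
    have "B = C" using perm_of_partition_next(1)[OF B] perm_of_partition_next(1)[OF C] e
      partition_block_unique[OF B(1) C(1)] by metis
    then have "cycle_of_list (sorted_list_of_set B) x = cycle_of_list (sorted_list_of_set B) y"
      using e perm_of_partition_block B C by metis
    then show "x = y" using permutes_inj[OF cycle_permutes] by (metis injD)
  qed
  then show "bij_betw (perm_of_partition P) {1..n} {1..n}"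
    using im unfolding bij_betw_def by (simp add: endo_inj_surj)
qed (rule perm_of_partition_outside)

lemma orbits_perm_of_partition: "orbit (perm_of_partition P) ` {1..n} = P"
proof (intro equalityI subsetI)
  fix B assume "B \<in> orbit (perm_of_partition P) ` {1..n}"
  then show "B \<in> P" using orbit_perm_of_partition partition_blockE by (metis imageE)
next
  fix B assume B: "B \<in> P"
  then obtain x where x: "x \<in> B" using partition_onD3[OF P] by (metis ex_in_conv)
  then show "B \<in> orbit (perm_of_partition P) ` {1..n}"
    using orbit_perm_of_partition[OF B x] partition_block_subset[OF B] by auto
qed

text \<open>Within \<open>{1..n}\<close> such a set is a union of blocks, and all points outside are
  fixed.\<close>

lemma stable_perm_of_partition:
  assumes "\<And>C u v. C \<in> P \<Longrightarrow> u \<in> C \<Longrightarrow> v \<in> C \<Longrightarrow> u \<in> I \<Longrightarrow> v \<in> I"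
  shows "stable (perm_of_partition P) I"
  unfolding stable_def
proof
  fix y show "perm_of_partition P y \<in> I \<longleftrightarrow> y \<in> I"
  proof (cases "y \<in> {1..n}")
    case True
    then obtain C where "C \<in> P" "y \<in> C" using partition_blockE by metis
    then show ?thesis using assms perm_of_partition_next(1) by metis
  qed (simp add: perm_of_partition_outside)
qed

text \<open>Let another block meet the gap or the hull spanned by \<open>x\<close> and its image. If
  it also had a point outside, four points alternating between the two blocks would be a
  crossing.\<close>

lemma nested_perm_of_partition:
  assumes nc: "noncrossing P"
  shows "nested n (perm_of_partition P)"
  unfolding nested_def
proof (intro ballI conjI impI)
  fix x assume x: "x \<in> {1..n}"
  let ?s = "perm_of_partition P x"
  obtain B where B: "B \<in> P" "x \<in> B" using partition_blockE[OF x] .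
  note nx = perm_of_partition_next[OF B]
  have cr: "C = D" if "C \<in> P" "D \<in> P" "a < b" "b < c" "c < d" "a \<in> C" "c \<in> C" "b \<in> D" "d \<in> D" for C D a b c d
    using nc that unfolding noncrossing_def by blast
  show "stable (perm_of_partition P) {x<..<?s}" if l: "x < ?s"
  proof (rule stable_perm_of_partition)
    fix C u v assume C: "C \<in> P" "u \<in> C" "v \<in> C" and u: "u \<in> {x<..<?s}"
    then have CB: "C \<noteq> B" using nx(2)[OF l, of u] by auto
    have "v \<noteq> x" "v \<noteq> ?s" using partition_block_unique[OF C(1) B(1)] CB C B nx(1) by auto
    moreover have "\<not> v < x" using cr[of C B v x u ?s] C B nx(1) u CB by auto
    moreover have "\<not> ?s < v" using cr[of B C x u ?s v] C B nx(1) u CB by auto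
    ultimately show "v \<in> {x<..<?s}" by auto
  qed
  show "stable (perm_of_partition P) {?s..x}" if l: "?s \<le> x"
  proof (rule stable_perm_of_partition)
    fix C u v assume C: "C \<in> P" "u \<in> C" "v \<in> C" and u: "u \<in> {?s..x}"
    show "v \<in> {?s..x}"
    proof (cases "C = B")
      case True
      then show ?thesis using nx(3)[OF l] C by auto
    next
      case False
      have "u \<noteq> x" "u \<noteq> ?s" using partition_block_unique[OF C(1) B(1)] False C B nx(1) by auto
      then have u': "?s < u" "u < x" using u by auto
      have "\<not> v < ?s" using cr[of C B v ?s u x] C B nx(1) u' False by auto
      moreover have "\<not> x < v" using cr[of B C ?s u x v] C B nx(1) u' False by auto
      ultimately show ?thesis by auto
    qed
  qed
qed

end

section \<open>From nested permutations back to partitions\<close>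

context
  fixes n :: nat and a :: "nat \<Rightarrow> nat"
  assumes a: "a permutes {1..n}" and Q: "nested n a"
begin

lemma nested_orbit:
  assumes "x \<in> {1..n}"
  shows "x < a x \<Longrightarrow> z \<in> orbit a x \<Longrightarrow> \<not> (x < z \<and> z < a x)"
    and "a x \<le> x \<Longrightarrow> orbit a x \<subseteq> {a x..x}"
proof -
  note pa = permutation_of_permutes_nat[OF a]
  show "\<not> (x < z \<and> z < a x)" if "x < a x" "z \<in> orbit a x"
  proof
    assume "x < z \<and> z < a x"
    moreover have "stable a {x<..<a x}" using Q assms that unfolding nested_def by auto
    ultimately have "orbit a z \<subseteq> {x<..<a x}" by (intro stable_orbit) auto
    moreover have "x \<in> orbit a z" using orbit_eq_if_mem[OF pa that(2)] permutation_self_in_orbit[OF pa] by auto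
    ultimately show False by auto
  qed
  show "orbit a x \<subseteq> {a x..x}" if "a x \<le> x"
    using Q assms that unfolding nested_def by (intro stable_orbit) auto
qed

lemma partition_on_orbits: "partition_on {1..n} (orbit a ` {1..n})"
proof (rule partition_onI)
  note pa = permutation_of_permutes_nat[OF a]
  show "\<Union> (orbit a ` {1..n}) = {1..n}"
    using permutes_orbit_subset[OF a] permutation_self_in_orbit[OF pa] by blast
  show "disjnt p q" if "p \<in> orbit a ` {1..n}" "q \<in> orbit a ` {1..n}" "p \<noteq> q" for p q
    using that orbit_eq_if_mem[OF pa] unfolding disjnt_def by blast
  show "{} \<notin> orbit a ` {1..n}"
    using orbit_nonempty by (metis imageE)
qed

lemma noncrossing_orbits: "noncrossing (orbit a ` {1..n})"
  unfolding noncrossing_def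
proof (intro ballI allI impI)
  note pa = permutation_of_permutes_nat[OF a]
  fix A B p q r s
  assume A: "A \<in> orbit a ` {1..n}" and B: "B \<in> orbit a ` {1..n}"
    and o: "p < q" "q < r" "r < s" and pA: "p \<in> A" and rA: "r \<in> A" and qB: "q \<in> B" and sB: "s \<in> B"
  have oA: "orbit a z = A" if "z \<in> A" for z using A that orbit_eq_if_mem[OF pa] by auto
  have oB: "orbit a z = B" if "z \<in> B" for z using B that orbit_eq_if_mem[OF pa] by auto
  have An: "A \<subseteq> {1..n}" using A permutes_orbit_subset[OF a] by blast
  show "A = B"
  proof (rule ccontr)
    assume AB: "A \<noteq> B"
    \<comment> \<open>\<open>x\<close> is the last element of \<open>A\<close> before
      \<open>q\<close>, so the gap from \<open>x\<close> to \<open>a x\<close> contains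
      \<open>q\<close>. Stability pulls all of \<open>B\<close> into it, including \<open>s\<close>;
      then \<open>r < s\<close> lies in the gap too, although \<open>r\<close> belongs to the orbit
      of \<open>x\<close>.\<close>
    define x where "x = Max {z \<in> A. z < q}"
    have fin: "finite {z \<in> A. z < q}" using An finite_subset[of A "{1..n}"] by auto
    have "x \<in> {z \<in> A. z < q}" unfolding x_def using fin pA o by (intro Max_in) auto
    then have x: "x \<in> A" "x < q" by auto
    have xn: "x \<in> {1..n}" using An x by auto
    have mx: "z \<le> x" if "z \<in> A" "z < q" for z
      unfolding x_def using fin that by (intro Max_ge) auto
    have axA: "a x \<in> A" using oA[OF x(1)] orbit.base[of a x] by simp
    have l: "x < a x"
    proof (rule ccontr)
      assume "\<not> x < a x"
      then have "A \<subseteq> {a x..x}" using nested_orbit(2)[OF xn] oA[OF x(1)] by simp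
      then show False using rA x o by auto
    qed
    have "a x \<noteq> q" using axA qB oA oB AB by metis
    moreover have "\<not> a x < q" using mx[OF axA] l by auto
    ultimately have "q < a x" by linarith
    then have q: "q \<in> {x<..<a x}" using x by auto
    have st: "stable a {x<..<a x}" using Q xn l unfolding nested_def by auto
    have "B \<subseteq> {x<..<a x}" using stable_orbit[OF st q] oB[OF qB] by simp
    then have "r < a x" using sB o by auto
    then show False using nested_orbit(1)[OF xn l, of r] oA[OF x(1)] rA x o by auto
  qed
qed

text \<open>Both permutations send \<open>x\<close> to the next larger element of its orbit, or from
  the maximum to the minimum: neither image can lie strictly between \<open>x\<close> and the
  other.\<close>

lemma perm_of_partition_orbits: "perm_of_partition (orbit a ` {1..n}) = a"
proof
  note pa = permutation_of_permutes_nat[OF a]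
  let ?P = "orbit a ` {1..n}"
  let ?s = "perm_of_partition ?P"
  note P = partition_on_orbits
  fix x show "?s x = a x"
  proof (cases "x \<in> {1..n}")
    case True
    let ?B = "orbit a x"
    have B: "?B \<in> ?P" "x \<in> ?B" using True permutation_self_in_orbit[OF pa] by auto
    note nx = perm_of_partition_next[OF P B]
    note no = nested_orbit[OF True]
    have ax: "a x \<in> ?B" by (rule orbit.base)
    have sx: "?s x \<in> ?B" by (rule nx(1))
    show ?thesis
    proof (cases "x < a x")
      case l: True
      have l': "x < ?s x" using nx(3) l ax by (meson atLeastAtMost_iff leD not_le_imp_less subsetD)
      show ?thesis using no(1)[OF l sx] nx(2)[OF l' ax] l l' by auto
    next
      case l: False
      then have b: "?B \<subseteq> {a x..x}" using no(2) by simp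
      then have "?s x \<le> x" "a x \<le> ?s x" using sx by auto
      then show ?thesis using nx(3) ax by auto
    qed
  next
    case False
    then show ?thesis using perm_of_partition_outside[OF P False] a by (auto simp: permutes_def)
  qed
qed

end

lemma bij_betw_perm_of_partition:
  "bij_betw perm_of_partition (NC n) {a. a permutes {1..n} \<and> nested n a}"
proof (rule bij_betw_byWitness[where f' = "\<lambda>a. orbit a ` {1..n}"])
  show "\<forall>P\<in>NC n. orbit (perm_of_partition P) ` {1..n} = P"
    unfolding NC_def using orbits_perm_of_partition by auto
  show "\<forall>a\<in>{a. a permutes {1..n} \<and> nested n a}. perm_of_partition (orbit a ` {1..n}) = a"
    using perm_of_partition_orbits by auto
  show "perm_of_partition ` NC n \<subseteq> {a. a permutes {1..n} \<and> nested n a}"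
    unfolding NC_def using perm_of_partition_permutes nested_perm_of_partition by auto
  show "(\<lambda>a. orbit a ` {1..n}) ` {a. a permutes {1..n} \<and> nested n a} \<subseteq> NC n"
    unfolding NC_def using partition_on_orbits noncrossing_orbits by auto
qed

lemma nc_moment_eq:
  "nc_moment n l = (\<Sum>a | a permutes {1..n} \<and> nested n a. \<Sum>b | b permutes {1..n} \<and> nested n b.
     l ^ num_cycles n (Hilbert_Choice.inv a \<circ> b))"
  unfolding nc_moment_def
  by (subst sum.reindex_bij_betw[OF bij_betw_perm_of_partition, symmetric], rule sum.cong[OF refl],
      subst sum.reindex_bij_betw[OF bij_betw_perm_of_partition, symmetric], rule refl)

section \<open>Wick calculus\<close>

text \<open>The expectation of \<open>X ^ p * cnj X ^ q\<close> for a standard complex Gaussian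
  \<open>X\<close>.\<close>

definition complex_gauss_mom :: "nat \<Rightarrow> nat \<Rightarrow> complex" where
  "complex_gauss_mom p q = (if p = q then fact p else 0)"

text \<open>Numerical form of integration by parts: one conjugate factor is paired with any of the
  \<open>p\<close> factors. At \<open>p = 0\<close> the truncated \<open>p - 1\<close> is multiplied
  by zero.\<close>

lemma complex_gauss_mom_Suc_right: "complex_gauss_mom p (Suc q) = of_nat p * complex_gauss_mom (p - 1) q"
  by (cases p) (auto simp: complex_gauss_mom_def)

lemma complex_gauss_mom_Suc_left: "complex_gauss_mom (Suc p) q = of_nat q * complex_gauss_mom p (q - 1)"
  by (cases q) (auto simp: complex_gauss_mom_def)

text \<open>Moments of a centred real Gaussian of variance 1/2: for \<open>k = 2 * j\<close> there
  are \<open>fact k / (2 ^ j * fact j)\<close> pairings, each of weight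
  \<open>(1 / 2) ^ j\<close>.\<close>

definition gauss_mom :: "nat \<Rightarrow> real" where
  "gauss_mom k = (if even k then fact k / (4 ^ (k div 2) * fact (k div 2)) else 0)"

lemma gauss_mom_0: "gauss_mom 0 = 1"
  by (simp add: gauss_mom_def)

lemma gauss_mom_Suc: "gauss_mom (Suc k) = real k / 2 * gauss_mom (k - 1)"
proof (cases "even k")
  case False
  then obtain j where k: "k = 2 * j + 1" by (elim oddE)
  have "gauss_mom (Suc k) = fact (2 * j + 2) / (4 ^ (j + 1) * fact (j + 1))"
    by (simp add: gauss_mom_def k)
  also have "\<dots> = (real (2 * j + 1) / 2) * (fact (2 * j) / (4 ^ j * fact j))"
    by (simp add: divide_simps)
  finally show ?thesis by (simp add: gauss_mom_def k)
qed (cases k; auto simp: gauss_mom_def)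

text \<open>\<open>F a b p q\<close> stands for the expectation of \<open>R\<^sup>a I\<^sup>b X\<^sup>p X*\<^sup>q\<close> for \<open>X = R + \<i> I\<close>; the
  proof integrates by parts in \<open>R\<close> and in \<open>I\<close>.\<close>

lemma complex_gauss_recursion:
  fixes F :: "nat \<Rightarrow> nat \<Rightarrow> nat \<Rightarrow> nat \<Rightarrow> complex"
  assumes base: "\<And>a b. F a b 0 0 = of_real (gauss_mom a) * of_real (gauss_mom b)"
    and P: "\<And>a b p q. F a b (Suc p) q = F (Suc a) b p q + \<i> * F a (Suc b) p q"
    and Q: "\<And>a b p q. F a b p (Suc q) = F (Suc a) b p q - \<i> * F a (Suc b) p q"
  shows "F 0 0 p q = complex_gauss_mom p q"
proof -
  \<comment> \<open>Integration by parts in the real part, with 1/2 the variance. The derivatives of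
    \<open>X\<close> and \<open>cnj X\<close> in this direction are both 1.\<close>
  have R: "F (Suc a) b p q = (of_nat a * F (a - 1) b p q + of_nat p * F a b (p - 1) q + of_nat q * F a b p (q - 1)) / 2"
    for a b p q
  proof (induction p arbitrary: a b)
    case 0
    show ?case
    proof (induction q arbitrary: a b)
      case 0
      show ?case by (simp add: base gauss_mom_Suc)
    next
      case (Suc q)
      show ?case unfolding Q[of "Suc a"] Suc
        by (cases a; cases q) (simp_all add: Q algebra_simps add_divide_distrib diff_divide_distrib)
    qed
  next
    case (Suc p)
    show ?case unfolding P[of "Suc a"] Suc
      by (cases a; cases p) (simp_all add: P algebra_simps add_divide_distrib diff_divide_distrib)
  qed
  \<comment> \<open>In the imaginary direction the derivatives of \<open>X\<close> and
    \<open>cnj X\<close> are \<open>\<i>\<close> and \<open>- \<i>\<close>.\<close>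
  have I: "F a (Suc b) p q = (of_nat b * F a (b - 1) p q + \<i> * of_nat p * F a b (p - 1) q - \<i> * of_nat q * F a b p (q - 1)) / 2"
    for a b p q
  proof (induction p arbitrary: a b)
    case 0
    show ?case
    proof (induction q arbitrary: a b)
      case 0
      show ?case by (simp add: base gauss_mom_Suc)
    next
      case (Suc q)
      show ?case unfolding Q[of a "Suc b"] Suc
        by (cases b; cases q) (simp_all add: Q algebra_simps add_divide_distrib diff_divide_distrib)
    qed
  next
    case (Suc p)
    show ?case unfolding P[of a "Suc b"] Suc
      by (cases b; cases p) (simp_all add: P algebra_simps add_divide_distrib diff_divide_distrib)
  qed
  \<comment> \<open>In the combination giving \<open>X\<close>, the terms from differentiating
    \<open>X\<close> cancel and those from differentiating \<open>cnj X\<close> double.\<close>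
  have 1: "F 0 0 (Suc p) q = of_nat q * F 0 0 p (q - 1)" for p q
    unfolding P R I by (simp add: field_simps)
  have 2: "F 0 0 0 (Suc q) = 0" for q
    unfolding Q R I by (simp add: field_simps)
  show ?thesis
  proof (induction p arbitrary: q)
    case 0
    then show ?case by (cases q) (auto simp: 2 complex_gauss_mom_def base gauss_mom_0)
  next
    case (Suc p)
    then show ?case by (simp add: 1 complex_gauss_mom_Suc_left)
  qed
qed

section \<open>Moments of a single Gaussian entry\<close>

context prob_space
begin

lemma gauss_moment:
  assumes "distributed M lborel X (\<lambda>x. ennreal (normal_density 0 (1 / sqrt 2) x))"
  shows "integrable M (\<lambda>w. X w ^ k)" and "expectation (\<lambda>w. X w ^ k) = gauss_mom k"
proof -
  have s: "(0::real) < 1 / sqrt 2" by simp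
  show "integrable M (\<lambda>w. X w ^ k)"
    using distributed_integrable[OF assms, of "\<lambda>x. x ^ k"] integrable_normal_moment[OF s, of 0 k] by simp
  have "expectation (\<lambda>w. X w ^ k) = (\<integral>x. normal_density 0 (1 / sqrt 2) x * (x - 0) ^ k \<partial>lborel)"
    using distributed_integral[OF assms, of "\<lambda>x. x ^ k"] by simp
  also have "\<dots> = gauss_mom k"
  proof (cases "even k")
    case True
    then obtain j where k: "k = 2 * j" by (elim evenE)
    show ?thesis unfolding k integral_normal_moment_even[OF s] by (simp add: gauss_mom_def power_divide)
  next
    case False
    then obtain j where k: "k = 2 * j + 1" by (elim oddE)
    show ?thesis unfolding k integral_normal_moment_odd[OF s] by (simp add: gauss_mom_def)
  qed
  finally show "expectation (\<lambda>w. X w ^ k) = gauss_mom k" .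
qed

lemma complex_gauss_moment:
  assumes "std_complex_gaussian M X"
  shows "integrable M (\<lambda>w. X w ^ p * cnj (X w) ^ q)" 
    and "expectation (\<lambda>w. X w ^ p * cnj (X w) ^ q) = complex_gauss_mom p q"
proof -
  from assms have ind: "indep_var borel (\<lambda>w. Re (X w)) borel (\<lambda>w. Im (X w))"
    and re: "distributed M lborel (\<lambda>w. Re (X w)) (\<lambda>x. ennreal (normal_density 0 (1 / sqrt 2) x))"
    and im: "distributed M lborel (\<lambda>w. Im (X w)) (\<lambda>x. ennreal (normal_density 0 (1 / sqrt 2) x))"
    unfolding std_complex_gaussian_def by auto
  \<comment> \<open>The additional powers of the real and imaginary parts close the family under
    expanding one factor \<open>X\<close> or \<open>cnj X\<close>. At \<open>p = q = 0\<close>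
    independence of the two parts applies.\<close>
  define f where "f a b p q w = of_real (Re (X w) ^ a) * of_real (Im (X w) ^ b) * (X w ^ p * cnj (X w) ^ q)" for a b p q w
  have c: "X w = of_real (Re (X w)) + \<i> * of_real (Im (X w))" for w by (simp add: complex_eq_iff)
  have c': "cnj (X w) = of_real (Re (X w)) - \<i> * of_real (Im (X w))" for w by (simp add: complex_eq_iff)
  have fP: "f a b (Suc p) q w = f (Suc a) b p q w + \<i> * f a (Suc b) p q w" for a b p q w
  proof -
    have "f a b (Suc p) q w = (of_real (Re (X w)) + \<i> * of_real (Im (X w))) * f a b p q w"
      unfolding c[symmetric] by (simp add: f_def)
    then show ?thesis by (simp add: f_def algebra_simps)
  qed
  have fQ: "f a b p (Suc q) w = f (Suc a) b p q w - \<i> * f a (Suc b) p q w" for a b p q w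
  proof -
    have "f a b p (Suc q) w = (of_real (Re (X w)) - \<i> * of_real (Im (X w))) * f a b p q w"
      unfolding c'[symmetric] by (simp add: f_def)
    then show ?thesis by (simp add: f_def algebra_simps)
  qed
  have ind': "indep_var borel (\<lambda>w. complex_of_real (Re (X w) ^ a)) borel (\<lambda>w. complex_of_real (Im (X w) ^ b))" for a b
    using indep_var_compose[OF ind, of "\<lambda>x. complex_of_real (x ^ a)" borel "\<lambda>x. complex_of_real (x ^ b)" borel]
    by (simp add: comp_def)
  have i1: "integrable M (\<lambda>w. complex_of_real (Re (X w) ^ a))" for a
    using gauss_moment(1)[OF re] by (simp only: integrable_of_real)
  have i2: "integrable M (\<lambda>w. complex_of_real (Im (X w) ^ a))" for a
    using gauss_moment(1)[OF im] by (simp only: integrable_of_real)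
  have int: "integrable M (f a b p q)" for a b p q
  proof (induction p arbitrary: a b)
    case 0
    show ?case
    proof (induction q arbitrary: a b)
      case 0
      show ?case using indep_var_integrable[OF ind' i1 i2, of a b] unfolding f_def by simp
    next
      case (Suc q)
      then show ?case unfolding fQ by (intro Bochner_Integration.integrable_diff integrable_mult_right)
    qed
  next
    case (Suc p)
    then show ?case unfolding fP by (intro Bochner_Integration.integrable_add integrable_mult_right)
  qed
  have F: "expectation (f 0 0 p q) = complex_gauss_mom p q"
  proof (rule complex_gauss_recursion[of "\<lambda>a b p q. expectation (f a b p q)"])
    fix a b p q
    show "expectation (f a b 0 0) = of_real (gauss_mom a) * of_real (gauss_mom b)"
      using indep_var_lebesgue_integral[OF ind' i1 i2, of a b] gauss_moment(2)[OF re] gauss_moment(2)[OF im]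
      unfolding f_def by (simp add: integral_complex_of_real del: of_real_power)
    show "expectation (f a b (Suc p) q) = expectation (f (Suc a) b p q) + \<i> * expectation (f a (Suc b) p q)"
      unfolding fP using int by (subst Bochner_Integration.integral_add) auto
    show "expectation (f a b p (Suc q)) = expectation (f (Suc a) b p q) - \<i> * expectation (f a (Suc b) p q)"
      unfolding fQ using int by (subst Bochner_Integration.integral_diff) auto
  qed
  have "f 0 0 p q = (\<lambda>w. X w ^ p * cnj (X w) ^ q)" by (simp add: fun_eq_iff f_def)
  then show "integrable M (\<lambda>w. X w ^ p * cnj (X w) ^ q)" 
    and "expectation (\<lambda>w. X w ^ p * cnj (X w) ^ q) = complex_gauss_mom p q"
    using int[of 0 0 p q] F by auto
qed

end

section \<open>Wick's formula by counting bijections\<close>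

text \<open>Extending by the identity outside the domain makes \<open>bijs A A\<close> the permutations of \<open>A\<close>.\<close>

definition bijs :: "'k set \<Rightarrow> 'k set \<Rightarrow> ('k \<Rightarrow> 'k) set" where
  "bijs A B = {s. bij_betw s A B \<and> (\<forall>x. x \<notin> A \<longrightarrow> s x = x)}"

lemma bijs_self: "bijs A A = {s. s permutes A}"
  unfolding bijs_def using bij_imp_permutes permutes_imp_bij permutes_not_in by (metis (no_types, lifting))

lemma finite_bijs: "finite A \<Longrightarrow> finite B \<Longrightarrow> finite (bijs A B)"
proof -
  assume fin: "finite A" "finite B"
  have "inj_on (\<lambda>s. restrict s A) (bijs A B)"
  proof (rule inj_onI, rule ext)
    fix s t x assume st: "s \<in> bijs A B" "t \<in> bijs A B" and "restrict s A = restrict t A"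
    from this(3) have "restrict s A x = restrict t A x" by (rule fun_cong)
    then show "s x = t x" using st by (cases "x \<in> A") (auto simp: bijs_def)
  qed
  moreover have "(\<lambda>s. restrict s A) ` bijs A B \<subseteq> PiE A (\<lambda>_. B)"
    by (auto simp: bijs_def dest: bij_betwE)
  ultimately show ?thesis using finite_PiE[of A "\<lambda>_. B"] fin inj_on_finite by blast
qed

text \<open>Once \<open>a\<close> is sent to \<open>b\<close>, a bijection from \<open>A\<close> to
  \<open>B - {b}\<close> remains. The update \<open>s(a := a)\<close> restores the convention that
  functions are the identity outside their domain.\<close>

lemma card_bijs_insert:
  assumes fin: "finite A" "finite B" and a: "a \<notin> A" and b: "b \<in> B"
  shows "card {s \<in> bijs (insert a A) B. (\<forall>k\<in>insert a A. u (s k) = v k) \<and> s a = b} =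
    (if u b = v a then card {s \<in> bijs A (B - {b}). \<forall>k\<in>A. u (s k) = v k} else 0)"
proof (cases "u b = v a")
  case True
  have "bij_betw (\<lambda>s. s(a := a)) {s \<in> bijs (insert a A) B. (\<forall>k\<in>insert a A. u (s k) = v k) \<and> s a = b}
     {s \<in> bijs A (B - {b}). \<forall>k\<in>A. u (s k) = v k}"
  proof (rule bij_betw_byWitness[where f' = "\<lambda>s. s(a := b)"])
    have "(s(a := a)) \<in> bijs A (B - {b})" if "s \<in> bijs (insert a A) B" "s a = b" for s
    proof -
      have "bij_betw s A (B - {b})"
        using that a unfolding bijs_def bij_betw_def by auto (metis imageI)
      then have "bij_betw (s(a := a)) A (B - {b})" using a by (subst bij_betw_cong[of _ _ s]) auto
      then show ?thesis using that unfolding bijs_def by auto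
    qed
    then show "(\<lambda>s. s(a := a)) ` {s \<in> bijs (insert a A) B. (\<forall>k\<in>insert a A. u (s k) = v k) \<and> s a = b}
       \<subseteq> {s \<in> bijs A (B - {b}). \<forall>k\<in>A. u (s k) = v k}"
      using a by auto
    have "s(a := b) \<in> bijs (insert a A) B" if "s \<in> bijs A (B - {b})" for s
    proof -
      have "bij_betw s A (B - {b})" using that unfolding bijs_def by auto
      then have "bij_betw (s(a := b)) A (B - {b})" using a by (subst bij_betw_cong[of _ _ s]) auto
      then have "bij_betw (s(a := b)) (A \<union> {a}) ((B - {b}) \<union> {b})"
        by (rule bij_betw_combine) (auto simp: bij_betw_def)
      moreover have "(B - {b}) \<union> {b} = B" using b by auto
      ultimately show ?thesis using that unfolding bijs_def by auto
    qed
    then show "(\<lambda>s. s(a := b)) ` {s \<in> bijs A (B - {b}). \<forall>k\<in>A. u (s k) = v k}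
       \<subseteq> {s \<in> bijs (insert a A) B. (\<forall>k\<in>insert a A. u (s k) = v k) \<and> s a = b}"
      using a True by auto
  qed (use a in \<open>auto simp: bijs_def\<close>)
  then show ?thesis using True by (simp add: bij_betw_same_card)
next
  case False
  then have "{s \<in> bijs (insert a A) B. (\<forall>k\<in>insert a A. u (s k) = v k) \<and> s a = b} = {}" by auto
  then show ?thesis using False by (simp only: card.empty if_False)
qed

text \<open>The induction removes \<open>a\<close> from \<open>A\<close> and its image from
  \<open>B\<close>. As these points differ in general, domain and codomain have to be separate sets,
  although only \<open>A = B\<close> is wanted in the end.\<close>

lemma prod_mom_eq_card:
  assumes "finite A" "finite B" "finite I" "u ` B \<subseteq> I" "v ` A \<subseteq> I"
  shows "(\<Prod>i\<in>I. complex_gauss_mom (card {k\<in>B. u k = i}) (card {k\<in>A. v k = i})) =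
    of_nat (card {s \<in> bijs A B. \<forall>k\<in>A. u (s k) = v k})"
  using assms
proof (induction A arbitrary: B rule: finite_induct)
  case empty
  show ?case
  proof (cases "B = {}")
    case True
    have "bijs {} ({} :: 'a set) = {id}" by (auto simp: bijs_def bij_betw_def)
    then show ?thesis using True by (simp add: complex_gauss_mom_def)
  next
    case False
    then obtain b where b: "b \<in> B" by auto
    \<comment> \<open>A factor labelled \<open>u b\<close> has no conjugate partner, so its moment
      vanishes, just as there is no bijection from the empty set onto \<open>B\<close>.\<close>
    have "card {k\<in>B. u k = u b} \<noteq> 0" using b empty by auto
    then have "complex_gauss_mom (card {k\<in>B. u k = u b}) 0 = 0" unfolding complex_gauss_mom_def by metis
    then have "(\<Prod>i\<in>I. complex_gauss_mom (card {k\<in>B. u k = i}) 0) = 0"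
      using b empty by (intro prod_zero) auto
    moreover have "bijs {} B = {}" using False by (auto simp: bijs_def bij_betw_def)
    ultimately show ?thesis by simp
  qed
next
  case (insert a A)
  let ?P = "\<lambda>B i. card {k\<in>B. u k = i}" and ?Q = "\<lambda>A i. card {k\<in>A. v k = i}"
  let ?N = "\<lambda>A B. {s \<in> bijs A B. \<forall>k\<in>A. u (s k) = v k}"
  have va: "v a \<in> I" using insert by auto
  have Q1: "?Q (insert a A) (v a) = Suc (?Q A (v a))"
  proof -
    have "{k\<in>insert a A. v k = v a} = insert a {k\<in>A. v k = v a}" by auto
    then show ?thesis using insert by simp
  qed
  have Q2: "?Q (insert a A) i = ?Q A i" if "i \<noteq> v a" for i
    using that by (intro arg_cong[of _ _ card]) auto
  have P1: "?P (B - {b}) i = (if i = v a then ?P B i - 1 else ?P B i)" if "b \<in> B" "u b = v a" for b i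
  proof (cases "i = v a")
    case True
    have "{k\<in>B - {b}. u k = i} = {k\<in>B. u k = i} - {b}" by auto
    then show ?thesis using that True by simp
  next
    case False
    then show ?thesis using that by (auto intro!: arg_cong[of _ _ card])
  qed
  have "(\<Prod>i\<in>I. complex_gauss_mom (?P B i) (?Q (insert a A) i)) =
     complex_gauss_mom (?P B (v a)) (Suc (?Q A (v a))) * (\<Prod>i\<in>I - {v a}. complex_gauss_mom (?P B i) (?Q A i))"
    using prod.remove[OF insert.prems(2) va, of "\<lambda>i. complex_gauss_mom (?P B i) (?Q (insert a A) i)"] Q1 Q2 by simp
  also have "\<dots> = of_nat (?P B (v a)) * (complex_gauss_mom (?P B (v a) - 1) (?Q A (v a)) * (\<Prod>i\<in>I - {v a}. complex_gauss_mom (?P B i) (?Q A i)))"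
    by (simp add: complex_gauss_mom_Suc_right)
  \<comment> \<open>The factor produced by the moment recursion is the number of admissible images
    \<open>b\<close> of \<open>a\<close>; it becomes a sum over them.\<close>
  also have "\<dots> = (\<Sum>b | b \<in> B \<and> u b = v a. complex_gauss_mom (?P B (v a) - 1) (?Q A (v a)) * (\<Prod>i\<in>I - {v a}. complex_gauss_mom (?P B i) (?Q A i)))"
    by simp
  also have "\<dots> = (\<Sum>b | b \<in> B \<and> u b = v a. \<Prod>i\<in>I. complex_gauss_mom (?P (B - {b}) i) (?Q A i))"
  proof (rule sum.cong[OF refl])
    fix b assume b: "b \<in> {b. b \<in> B \<and> u b = v a}"
    have "(\<Prod>i\<in>I. complex_gauss_mom (?P (B - {b}) i) (?Q A i)) = complex_gauss_mom (?P (B - {b}) (v a)) (?Q A (v a)) *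
        (\<Prod>i\<in>I - {v a}. complex_gauss_mom (?P (B - {b}) i) (?Q A i))"
      using prod.remove[OF insert.prems(2) va] by simp
    also have "\<dots> = complex_gauss_mom (?P B (v a) - 1) (?Q A (v a)) * (\<Prod>i\<in>I - {v a}. complex_gauss_mom (?P B i) (?Q A i))"
      using P1 b by simp
    finally show "complex_gauss_mom (?P B (v a) - 1) (?Q A (v a)) * (\<Prod>i\<in>I - {v a}. complex_gauss_mom (?P B i) (?Q A i)) =
       (\<Prod>i\<in>I. complex_gauss_mom (?P (B - {b}) i) (?Q A i))" ..
  qed
  also have "\<dots> = (\<Sum>b | b \<in> B \<and> u b = v a. of_nat (card (?N A (B - {b}))))"
    using insert.prems by (intro sum.cong refl insert.IH) auto
  also have "\<dots> = (\<Sum>b\<in>B. of_nat (card {s \<in> ?N (insert a A) B. s a = b}))"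
  proof -
    have "(\<Sum>b | b \<in> B \<and> u b = v a. of_nat (card (?N A (B - {b})))) =
        (\<Sum>b\<in>B. if u b = v a then of_nat (card (?N A (B - {b}))) else (0 :: complex))"
      using insert.prems(1) by (simp add: sum.inter_filter)
    also have "\<dots> = (\<Sum>b\<in>B. of_nat (card {s \<in> ?N (insert a A) B. s a = b}))"
    proof (rule sum.cong[OF refl])
      fix b assume b: "b \<in> B"
      have "{s \<in> ?N (insert a A) B. s a = b} =
          {s \<in> bijs (insert a A) B. (\<forall>k\<in>insert a A. u (s k) = v k) \<and> s a = b}" by auto
      then show "(if u b = v a then of_nat (card (?N A (B - {b}))) else (0 :: complex)) =
          of_nat (card {s \<in> ?N (insert a A) B. s a = b})"
        using card_bijs_insert[OF insert.hyps(1) insert.prems(1) insert.hyps(2) b, of u v] by simp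
    qed
    finally show ?thesis .
  qed
  also have "\<dots> = of_nat (\<Sum>b\<in>B. card {s \<in> ?N (insert a A) B. s a = b})" by simp
  also have "(\<Sum>b\<in>B. card {s \<in> ?N (insert a A) B. s a = b}) = card (?N (insert a A) B)"
  proof -
    have f: "finite (?N (insert a A) B)" using finite_bijs[of "insert a A" B] insert by simp
    have "?N (insert a A) B = (\<Union>b\<in>B. {s \<in> ?N (insert a A) B. s a = b})"
      by (auto simp: bijs_def bij_betw_def)
    also have "card \<dots> = (\<Sum>b\<in>B. card {s \<in> ?N (insert a A) B. s a = b})"
    proof (rule card_UN_disjoint)
      show "\<forall>b\<in>B. finite {s \<in> ?N (insert a A) B. s a = b}"
        by (intro ballI finite_subset[OF _ f]) auto
    qed (use insert.prems in auto)
    finally show ?thesis ..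
  qed
  finally show ?case .
qed

lemma prod_eq_prod_power:
  fixes x :: "'i \<Rightarrow> 'c :: comm_monoid_mult"
  assumes "finite A" "finite I" "u ` A \<subseteq> I"
  shows "(\<Prod>k\<in>A. x (u k)) = (\<Prod>i\<in>I. x i ^ card {k\<in>A. u k = i})"
proof -
  have "(\<Prod>k\<in>A. x (u k)) = (\<Prod>i\<in>I. \<Prod>k | k \<in> A \<and> u k = i. x (u k))"
    using prod.group[OF assms, of "\<lambda>k. x (u k)"] by simp
  also have "\<dots> = (\<Prod>i\<in>I. x i ^ card {k\<in>A. u k = i})"
    by (intro prod.cong refl) simp
  finally show ?thesis .
qed

text \<open>Grouping factors by label gives powers of independent variables, so the expectation is a
  product of single moments, which counts the label-preserving pairings.\<close>

lemma (in prob_space) wick: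
  assumes fin: "finite I" "finite A" and uv: "u ` A \<subseteq> I" "v ` A \<subseteq> I"
    and ind: "indep_vars (\<lambda>_. borel) X I"
    and g: "\<And>i. i \<in> I \<Longrightarrow> std_complex_gaussian M (X i)"
  shows "integrable M (\<lambda>w. \<Prod>k\<in>A. X (u k) w * cnj (X (v k) w))"
    and "expectation (\<lambda>w. \<Prod>k\<in>A. X (u k) w * cnj (X (v k) w)) =
      of_nat (card {s. s permutes A \<and> (\<forall>k\<in>A. u (s k) = v k)})"
proof -
  let ?p = "\<lambda>i. card {k\<in>A. u k = i}" and ?q = "\<lambda>i. card {k\<in>A. v k = i}"
  have eq: "(\<Prod>k\<in>A. X (u k) w * cnj (X (v k) w)) = (\<Prod>i\<in>I. X i w ^ ?p i * cnj (X i w) ^ ?q i)" for w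
    using prod_eq_prod_power[OF fin(2,1) uv(1), of "\<lambda>i. X i w"]
      prod_eq_prod_power[OF fin(2,1) uv(2), of "\<lambda>i. cnj (X i w)"]
    by (simp add: prod.distrib)
  have cnj_meas: "cnj \<in> borel_measurable borel"
    by (intro borel_measurable_continuous_onI continuous_intros)
  have ind': "indep_vars (\<lambda>_. borel) (\<lambda>i w. X i w ^ ?p i * cnj (X i w) ^ ?q i) I"
    using cnj_meas by (intro indep_vars_compose2[OF ind, of "\<lambda>i z. z ^ ?p i * cnj z ^ ?q i" "\<lambda>_. borel"]) measurable
  note m = complex_gauss_moment[OF g]
  show "integrable M (\<lambda>w. \<Prod>k\<in>A. X (u k) w * cnj (X (v k) w))"
    unfolding eq by (rule indep_vars_integrable[OF fin(1) ind' m(1)])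
  have "expectation (\<lambda>w. \<Prod>k\<in>A. X (u k) w * cnj (X (v k) w)) = (\<Prod>i\<in>I. complex_gauss_mom (?p i) (?q i))"
    unfolding eq using indep_vars_lebesgue_integral[OF fin(1) ind' m(1)] m(2) by simp
  also have "\<dots> = of_nat (card {s. s permutes A \<and> (\<forall>k\<in>A. u (s k) = v k)})"
    using prod_mom_eq_card[OF fin(2,2,1) uv] by (simp add: bijs_self)
  finally show "expectation (\<lambda>w. \<Prod>k\<in>A. X (u k) w * cnj (X (v k) w)) =
      of_nat (card {s. s permutes A \<and> (\<forall>k\<in>A. u (s k) = v k)})" .
qed

section \<open>The trace expansion\<close>

lemma sum_PiE_insert:
  assumes "x \<notin> S"
  shows "(\<Sum>p\<in>PiE (insert x S) T. f p) = (\<Sum>g\<in>PiE S T. \<Sum>y\<in>T x. f (g(x := y)))"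
proof -
  have "(\<Sum>p\<in>PiE (insert x S) T. f p) = (\<Sum>(y, g)\<in>T x \<times> PiE S T. f (g(x := y)))"
    unfolding PiE_insert_eq using inj_combinator[OF assms]
    by (subst sum.reindex) (auto intro!: sum.cong)
  also have "\<dots> = (\<Sum>y\<in>T x. \<Sum>g\<in>PiE S T. f (g(x := y)))" by (rule sum.cartesian_product[symmetric])
  finally show ?thesis by (subst sum.swap)
qed

text \<open>The starting index is imposed by a condition on \<open>p 1\<close>, so that a path is a
  function on \<open>{1..n}\<close> alone. Summing over \<open>i\<close> then removes the condition
  and closes the path.\<close>

lemma pow_mat_entry:
  fixes A :: "complex Matrix.mat"
  assumes A: "A \<in> carrier_mat D D" and n: "n \<ge> 1" and ij: "i < D" "j < D"
  shows "(A ^\<^sub>m n) $$ (i, j) = (\<Sum>p\<in>PiE {1..n} (\<lambda>_. {..<D}).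
    if p 1 = i then (\<Prod>k\<in>{1..<n}. A $$ (p k, p (Suc k))) * A $$ (p n, j) else 0)"
  using n ij(2)
proof (induction n arbitrary: j rule: dec_induct)
  case base
  have "{1..1} = insert 1 ({} :: nat set)" by auto
  then have "(\<Sum>p\<in>PiE {1..1} (\<lambda>_. {..<D}). if p 1 = i then (\<Prod>k\<in>{1..<1}. A $$ (p k, p (Suc k))) * A $$ (p 1, j) else 0)
     = (\<Sum>y<D. if y = i then A $$ (y, j) else 0)" by (simp only: sum_PiE_insert[OF empty_iff[THEN iffD1, THEN notI]] PiE_empty_domain) simp
  also have "\<dots> = A $$ (i, j)" using ij(1) by simp
  finally show ?case using A by simp
next
  case (step n)
  have An: "A ^\<^sub>m n \<in> carrier_mat D D" using A by simp
  have ins: "{1..Suc n} = insert (Suc n) {1..n}" by auto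
  have "(A ^\<^sub>m Suc n) $$ (i, j) = (\<Sum>r<D. (A ^\<^sub>m n) $$ (i, r) * A $$ (r, j))"
    using A An ij(1) step.prems by (simp add: scalar_prod_def atLeast0LessThan)
  also have "\<dots> = (\<Sum>r<D. \<Sum>p\<in>PiE {1..n} (\<lambda>_. {..<D}).
      (if p 1 = i then (\<Prod>k\<in>{1..<n}. A $$ (p k, p (Suc k))) * A $$ (p n, r) else 0) * A $$ (r, j))"
    by (simp add: step.IH sum_distrib_right)
  also have "\<dots> = (\<Sum>p\<in>PiE {1..n} (\<lambda>_. {..<D}). \<Sum>r<D.
      (if p 1 = i then (\<Prod>k\<in>{1..<n}. A $$ (p k, p (Suc k))) * A $$ (p n, r) else 0) * A $$ (r, j))"
    by (rule sum.swap)
  also have "\<dots> = (\<Sum>p\<in>PiE {1..Suc n} (\<lambda>_. {..<D}).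
     if p 1 = i then (\<Prod>k\<in>{1..<Suc n}. A $$ (p k, p (Suc k))) * A $$ (p (Suc n), j) else 0)"
    unfolding ins
  proof (subst sum_PiE_insert, simp, intro sum.cong refl)
    fix p r
    have "{1..<Suc n} = insert n {1..<n}" using step.hyps by auto
    then have "(\<Prod>k\<in>{1..<Suc n}. A $$ ((p(Suc n := r)) k, (p(Suc n := r)) (Suc k))) =
       A $$ (p n, r) * (\<Prod>k\<in>{1..<n}. A $$ ((p(Suc n := r)) k, (p(Suc n := r)) (Suc k)))" by simp
    also have "(\<Prod>k\<in>{1..<n}. A $$ ((p(Suc n := r)) k, (p(Suc n := r)) (Suc k))) = (\<Prod>k\<in>{1..<n}. A $$ (p k, p (Suc k)))"
      by (intro prod.cong) auto
    finally show "(if p 1 = i then (\<Prod>k\<in>{1..<n}. A $$ (p k, p (Suc k))) * A $$ (p n, r) else 0) * A $$ (r, j) =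
      (if (p(Suc n := r)) 1 = i then (\<Prod>k\<in>{1..<Suc n}. A $$ ((p(Suc n := r)) k, (p(Suc n := r)) (Suc k))) * A $$ ((p(Suc n := r)) (Suc n), j) else 0)"
      using step.hyps by simp
  qed
  finally show ?case .
qed

lemma long_cycle_in: "k \<in> {1..n} \<Longrightarrow> long_cycle n k \<in> {1..n}"
  using permutes_in_image[OF long_cycle_permutes] by blast

lemma mat_trace_pow:
  fixes A :: "complex Matrix.mat"
  assumes A: "A \<in> carrier_mat D D" and n: "n \<ge> 1"
  shows "mat_trace (A ^\<^sub>m n) = (\<Sum>p\<in>PiE {1..n} (\<lambda>_. {..<D}). \<Prod>k\<in>{1..n}. A $$ (p k, p (long_cycle n k)))"
proof -
  have "mat_trace (A ^\<^sub>m n) = (\<Sum>i<D. (A ^\<^sub>m n) $$ (i, i))"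
    using A by (simp add: mat_trace_def)
  also have "\<dots> = (\<Sum>i<D. \<Sum>p\<in>PiE {1..n} (\<lambda>_. {..<D}).
    if p 1 = i then (\<Prod>k\<in>{1..<n}. A $$ (p k, p (Suc k))) * A $$ (p n, i) else 0)"
    by (intro sum.cong refl pow_mat_entry[OF A n]) auto
  also have "\<dots> = (\<Sum>p\<in>PiE {1..n} (\<lambda>_. {..<D}). \<Sum>i<D.
    if p 1 = i then (\<Prod>k\<in>{1..<n}. A $$ (p k, p (Suc k))) * A $$ (p n, i) else 0)"
    by (rule sum.swap)
  also have "\<dots> = (\<Sum>p\<in>PiE {1..n} (\<lambda>_. {..<D}). \<Prod>k\<in>{1..n}. A $$ (p k, p (long_cycle n k)))"
  proof (rule sum.cong[OF refl])
    fix p assume "p \<in> PiE {1..n} (\<lambda>_. {..<D})"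
    then have "p 1 < D" using n by auto
    moreover have "{1..n} = insert n {1..<n}" using n by auto
    moreover have "(\<Prod>k\<in>{1..<n}. A $$ (p k, p (long_cycle n k))) = (\<Prod>k\<in>{1..<n}. A $$ (p k, p (Suc k)))"
      by (intro prod.cong) (auto simp: long_cycle_def)
    moreover have "long_cycle n n = 1" using n by (simp add: long_cycle_def)
    ultimately show "(\<Sum>i<D. if p 1 = i then (\<Prod>k\<in>{1..<n}. A $$ (p k, p (Suc k))) * A $$ (p n, i) else 0) =
       (\<Prod>k\<in>{1..n}. A $$ (p k, p (long_cycle n k)))"
      by (simp add: sum.delta mult.commute)
  qed
  finally show ?thesis .
qed

lemma sum_PiE_mult:
  fixes d :: nat
  shows "(\<Sum>p\<in>PiE S (\<lambda>_. {..<d * d}). f p) =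
    (\<Sum>a\<in>PiE S (\<lambda>_. {..<d}). \<Sum>b\<in>PiE S (\<lambda>_. {..<d}). f (\<lambda>k\<in>S. a k * d + b k))"
proof -
  have "(\<Sum>p\<in>PiE S (\<lambda>_. {..<d * d}). f p) =
    (\<Sum>ab\<in>PiE S (\<lambda>_. {..<d}) \<times> PiE S (\<lambda>_. {..<d}). f (\<lambda>k\<in>S. fst ab k * d + snd ab k))"
  proof (rule sum.reindex_bij_witness[where i = "\<lambda>ab. (\<lambda>k\<in>S. fst ab k * d + snd ab k)"
        and j = "\<lambda>p. (\<lambda>k\<in>S. p k div d, \<lambda>k\<in>S. p k mod d)"])
    fix p assume p: "p \<in> PiE S (\<lambda>_. {..<d * d})"
    then have r: "(\<lambda>k\<in>S. p k) = p" by (simp add: PiE_def extensional_restrict restrict_def[symmetric] eta_contract_eq)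
    then show "(\<lambda>k\<in>S. fst (\<lambda>k\<in>S. p k div d, \<lambda>k\<in>S. p k mod d) k * d + snd (\<lambda>k\<in>S. p k div d, \<lambda>k\<in>S. p k mod d) k) = p"
      by (simp cong: restrict_cong)
    have "p k < d * d" if "k \<in> S" for k using p that by auto
    then have "p k div d < d" "p k mod d < d" if "k \<in> S" for k
      using that by (auto simp: less_mult_imp_div_less) (metis mod_less_divisor gr0I mult_0 not_less0)
    then show "(\<lambda>k\<in>S. p k div d, \<lambda>k\<in>S. p k mod d) \<in> PiE S (\<lambda>_. {..<d}) \<times> PiE S (\<lambda>_. {..<d})" by auto
    show "f (\<lambda>k\<in>S. fst (\<lambda>k\<in>S. p k div d, \<lambda>k\<in>S. p k mod d) k * d + snd (\<lambda>k\<in>S. p k div d, \<lambda>k\<in>S. p k mod d) k) = f p"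
      using r by (simp cong: restrict_cong)
  next
    fix ab assume ab: "ab \<in> PiE S (\<lambda>_. {..<d}) \<times> PiE S (\<lambda>_. {..<d})"
    then obtain a b where ab': "ab = (a, b)" "a \<in> PiE S (\<lambda>_. {..<d})" "b \<in> PiE S (\<lambda>_. {..<d})" by auto
    have b: "(a k * d + b k) div d = a k" "(a k * d + b k) mod d = b k" "b k < d" and a: "a k < d" if "k \<in> S" for k using ab' that by (auto simp: PiE_def Pi_def)
    show "(\<lambda>k\<in>S. fst ab k * d + snd ab k) \<in> PiE S (\<lambda>_. {..<d * d})"
      using a b by (auto simp: ab'(1) index_pair_less)
    have 1: "(\<lambda>k\<in>S. (\<lambda>k\<in>S. a k * d + b k) k div d) = a"
      using ab'(2) b by (intro ext) (auto simp: PiE_def extensional_def)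
    have 2: "(\<lambda>k\<in>S. (\<lambda>k\<in>S. a k * d + b k) k mod d) = b"
      using ab'(3) b by (intro ext) (auto simp: PiE_def extensional_def)
    show "(\<lambda>k\<in>S. (\<lambda>k\<in>S. fst ab k * d + snd ab k) k div d, \<lambda>k\<in>S. (\<lambda>k\<in>S. fst ab k * d + snd ab k) k mod d) = ab"
      unfolding ab'(1) fst_conv snd_conv 1 2 ..
  qed
  then show ?thesis by (simp add: sum.cartesian_product case_prod_beta)
qed

text \<open>The coordinates of \<open>Omega_vec\<close>. No conjugate appears, so for a complex
  basis this matrix need not be the identity.\<close>

definition overlap :: "nat \<Rightarrow> (nat \<Rightarrow> complex Matrix.vec) \<Rightarrow> nat \<Rightarrow> nat \<Rightarrow> complex" where
  "overlap l e i k = (\<Sum>m<l. e m $ i * e m $ k)"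

text \<open>Orthonormality says that a square matrix has its adjoint as a right inverse; the adjoint
  is then also a left inverse.\<close>

lemma orthonormal_basis_complete:
  assumes e: "orthonormal_basis l e" and uv: "u < l" "v < l"
  shows "(\<Sum>m<l. e m $ u * cnj (e m $ v)) = (if u = v then 1 else 0)"
proof -
  define E where "E = Matrix.mat l l (\<lambda>(m, i). e m $ i)"
  define F where "F = Matrix.mat l l (\<lambda>(i, m). cnj (e m $ i))"
  have dim: "dim_vec (e m) = l" if "m < l" for m using e that unfolding orthonormal_basis_def by auto
  have "E * F = 1\<^sub>m l"
  proof (rule eq_matI)
    fix i j assume "i < dim_row (1\<^sub>m l :: complex Matrix.mat)" "j < dim_col (1\<^sub>m l :: complex Matrix.mat)"
    then have ij: "i < l" "j < l" by auto
    have "(E * F) $$ (i, j) = e i \<bullet>c e j"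
      using ij dim by (simp add: E_def F_def scalar_prod_def)
    also have "\<dots> = (if i = j then 1 else 0)" using e ij unfolding orthonormal_basis_def by simp
    finally show "(E * F) $$ (i, j) = 1\<^sub>m l $$ (i, j)" using ij by simp
  qed (auto simp: E_def F_def)
  then have "F * E = 1\<^sub>m l"
    by (intro mat_mult_left_right_inverse[of E l F]) (auto simp: E_def F_def)
  then have "(F * E) $$ (v, u) = 1\<^sub>m l $$ (v, u)" by simp
  then show ?thesis using uv by (simp add: E_def F_def scalar_prod_def atLeast0LessThan mult.commute)
qed

text \<open>Summing over \<open>i\<close> applies orthonormality and identifies the two basis
  indices; completeness evaluates what is left.\<close>

lemma overlap_unitary:
  assumes e: "orthonormal_basis l e" and uv: "u < l" "v < l"
  shows "(\<Sum>i<l. overlap l e i u * cnj (overlap l e i v)) = (if u = v then 1 else 0)"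
proof -
  have dim: "dim_vec (e m) = l" if "m < l" for m using e that unfolding orthonormal_basis_def by auto
  have on: "(\<Sum>i<l. e m $ i * cnj (e m' $ i)) = (if m = m' then 1 else 0)" if "m < l" "m' < l" for m m'
  proof -
    have "e m \<bullet>c e m' = (if m = m' then 1 else 0)" using e that unfolding orthonormal_basis_def by simp
    then show ?thesis using dim that by (simp add: scalar_prod_def atLeast0LessThan)
  qed
  have "(\<Sum>i<l. overlap l e i u * cnj (overlap l e i v)) =
    (\<Sum>i<l. \<Sum>m<l. \<Sum>m'<l. (e m $ u * cnj (e m' $ v)) * (e m $ i * cnj (e m' $ i)))"
    unfolding overlap_def cnj_sum sum_product by (intro sum.cong refl) (simp add: mult_ac)
  also have "\<dots> = (\<Sum>m<l. \<Sum>i<l. \<Sum>m'<l. (e m $ u * cnj (e m' $ v)) * (e m $ i * cnj (e m' $ i)))"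
    by (rule sum.swap)
  also have "\<dots> = (\<Sum>m<l. \<Sum>m'<l. \<Sum>i<l. (e m $ u * cnj (e m' $ v)) * (e m $ i * cnj (e m' $ i)))"
    by (rule sum.cong[OF refl], rule sum.swap)
  also have "\<dots> = (\<Sum>m<l. \<Sum>m'<l. (e m $ u * cnj (e m' $ v)) * (if m = m' then 1 else 0))"
    by (intro sum.cong refl) (simp add: sum_distrib_left[symmetric] on)
  also have "\<dots> = (\<Sum>m<l. e m $ u * cnj (e m $ v))"
    by (intro sum.cong refl) (simp add: if_distrib[of "\<lambda>x. _ * x"] cong: if_cong)
  finally show ?thesis using orthonormal_basis_complete[OF e uv] by simp
qed

lemma Omega_vec_entry:
  assumes e: "orthonormal_basis l e" and ik: "i < l" "k < l"
  shows "Omega_vec l e $ (i * l + k) = overlap l e i k"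
proof -
  have dim: "dim_vec (e m) = l" if "m < l" for m using e that unfolding orthonormal_basis_def by auto
  have *: "(i * l + k) div l = i" "(i * l + k) mod l = k" using ik by auto
  show ?thesis
    using index_pair_less[OF ik] dim * unfolding Omega_vec_def overlap_def
    by (auto simp: kron_vec_def intro!: sum.cong)
qed

lemma omega_mat_entry:
  assumes "p < l * l" "q < l * l"
  shows "omega_mat l e $$ (p, q) = Omega_vec l e $ p * cnj (Omega_vec l e $ q)"
proof -
  have d: "dim_vec (Omega_vec l e) = l * l" by (simp add: Omega_vec_def)
  then have c: "Omega_vec l e \<in> carrier_vec (l * l)" by (metis carrier_vec_dim_vec)
  show ?thesis using assms c d
    by (simp add: omega_mat_def mat_adjoint_def scalar_prod_def mat_of_cols_def mat_of_rows_def)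
qed

lemma cp_map_matrix_unit:
  assumes G: "G \<in> carrier_mat (d * d) l" and ij: "i < l" "j < l" and ab: "a < d" "b < d"
  shows "cp_map d G (matrix_unit l i j) $$ (a, b) = (\<Sum>x<d. G $$ (a * d + x, i) * cnj (G $$ (b * d + x, j)))"
proof -
  have "(G * matrix_unit l i j * mat_adjoint G) $$ (p, q) = G $$ (p, i) * cnj (G $$ (q, j))"
    if "p < d * d" "q < d * d" for p q
  proof -
    have adj: "mat_adjoint G \<in> carrier_mat l (d * d)" "\<And>x. x < l \<Longrightarrow> mat_adjoint G $$ (x, q) = cnj (G $$ (q, x))"
      using G that by (auto simp: mat_adjoint_def mat_of_rows_def)
    have "(G * matrix_unit l i j) $$ (p, y) = (if y = j then G $$ (p, i) else 0)" if "y < l" for y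
    proof -
      have "(G * matrix_unit l i j) $$ (p, y) = (\<Sum>x<l. G $$ (p, x) * (if x = i \<and> y = j then 1 else 0))"
        using G that \<open>p < d * d\<close> by (simp add: scalar_prod_def matrix_unit_def atLeast0LessThan)
      also have "\<dots> = (if y = j then G $$ (p, i) else 0)" using ij by (simp add: if_distrib[of "\<lambda>x. _ * x"] cong: if_cong)
      finally show ?thesis .
    qed
    moreover have "(G * matrix_unit l i j * mat_adjoint G) $$ (p, q) =
       (\<Sum>y<l. (G * matrix_unit l i j) $$ (p, y) * mat_adjoint G $$ (y, q))"
      using G adj that by (simp add: scalar_prod_def matrix_unit_def atLeast0LessThan)
    ultimately have "(G * matrix_unit l i j * mat_adjoint G) $$ (p, q) =
       (\<Sum>y<l. (if y = j then G $$ (p, i) else 0) * cnj (G $$ (q, y)))" using adj by simp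
    also have "\<dots> = G $$ (p, i) * cnj (G $$ (q, j))" using ij by (simp add: if_distrib[of "\<lambda>x. x * _"] cong: if_cong)
    finally show ?thesis .
  qed
  then show ?thesis unfolding cp_map_def partial_trace2_def using ab by (simp add: index_pair_less)
qed

lemma Z_mat_carrier: "Z_mat l e d G H \<in> carrier_mat (d * d) (d * d)"
  by (simp add: Z_mat_def tensor_map_def)

text \<open>The labels \<open>x\<close> and \<open>x'\<close> are those traced out for
  \<open>G\<close> and \<open>H\<close>; \<open>s\<close>, \<open>s'\<close> and \<open>t\<close>,
  \<open>t'\<close> are the coordinates of the two factors of \<open>omega_mat\<close>.\<close>

lemma Z_mat_entry:
  assumes e: "orthonormal_basis l e" and G: "G \<in> carrier_mat (d * d) l" and H: "H \<in> carrier_mat (d * d) l"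
    and ab: "a < d" "b < d" "a' < d" "b' < d"
  shows "Z_mat l e d G H $$ (a * d + a', b * d + b') =
    (\<Sum>s<l. \<Sum>s'<l. \<Sum>t<l. \<Sum>t'<l. \<Sum>x<d. \<Sum>x'<d.
      (overlap l e s s' * cnj (overlap l e t t')) *
      (G $$ (a * d + x, s) * cnj (G $$ (b * d + x, t))) *
      (H $$ (a' * d + x', s') * cnj (H $$ (b' * d + x', t'))))"
proof -
  have dm: "(a * d + a') div d = a" "(a * d + a') mod d = a'" "(b * d + b') div d = b" "(b * d + b') mod d = b'"
    using ab by auto
  have cpd: "dim_row (cp_map d X Y) = d" "dim_col (cp_map d X Y) = d" for X Y
    by (auto simp: cp_map_def partial_trace2_def)
  have "Z_mat l e d G H $$ (a * d + a', b * d + b') = (\<Sum>s<l. \<Sum>t<l. \<Sum>s'<l. \<Sum>t'<l.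
      omega_mat l e $$ (s * l + s', t * l + t') *
       (cp_map d G (matrix_unit l s t) $$ (a, b) * cp_map d H (matrix_unit l s' t') $$ (a', b')))"
    unfolding Z_mat_def tensor_map_def kron_mat_def using ab by (simp add: index_pair_less dm cpd)
  also have "\<dots> = (\<Sum>s<l. \<Sum>t<l. \<Sum>s'<l. \<Sum>t'<l. \<Sum>x<d. \<Sum>x'<d.
      (overlap l e s s' * cnj (overlap l e t t')) *
      (G $$ (a * d + x, s) * cnj (G $$ (b * d + x, t))) *
      (H $$ (a' * d + x', s') * cnj (H $$ (b' * d + x', t'))))"
  proof (intro sum.cong refl)
    fix s t s' t' assume "s \<in> {..<l}" "t \<in> {..<l}" "s' \<in> {..<l}" "t' \<in> {..<l}"
    then show "omega_mat l e $$ (s * l + s', t * l + t') *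
       (cp_map d G (matrix_unit l s t) $$ (a, b) * cp_map d H (matrix_unit l s' t') $$ (a', b')) =
       (\<Sum>x<d. \<Sum>x'<d. (overlap l e s s' * cnj (overlap l e t t')) *
      (G $$ (a * d + x, s) * cnj (G $$ (b * d + x, t))) *
      (H $$ (a' * d + x', s') * cnj (H $$ (b' * d + x', t'))))"
      using index_pair_less[of s l s' l] index_pair_less[of t l t' l]
      by (simp only: lessThan_iff omega_mat_entry Omega_vec_entry[OF e] cp_map_matrix_unit[OF G _ _ ab(1,2)]
          cp_map_matrix_unit[OF H _ _ ab(3,4)] sum_product) (simp only: sum_distrib_left mult.assoc)
  qed
  also have "\<dots> = (\<Sum>s<l. \<Sum>s'<l. \<Sum>t<l. \<Sum>t'<l. \<Sum>x<d. \<Sum>x'<d.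
      (overlap l e s s' * cnj (overlap l e t t')) *
      (G $$ (a * d + x, s) * cnj (G $$ (b * d + x, t))) *
      (H $$ (a' * d + x', s') * cnj (H $$ (b' * d + x', t'))))"
    by (rule sum.cong[OF refl], rule sum.swap)
  finally show ?thesis .
qed

text \<open>Every summation label becomes a function on \<open>{1..n}\<close>. Closing the trace
  makes the column label at \<open>k\<close> the row label at \<open>long_cycle n k\<close>, so the
  long cycle enters only through the conjugated entries.\<close>

lemma mat_trace_Z_pow:
  assumes e: "orthonormal_basis l e" and G: "G \<in> carrier_mat (d * d) l" and H: "H \<in> carrier_mat (d * d) l"
    and n: "n \<ge> 1"
  defines "Fd \<equiv> PiE {1..n} (\<lambda>_. {..<d})" and "Fl \<equiv> PiE {1..n} (\<lambda>_. {..<l})"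
  shows "mat_trace ((c \<cdot>\<^sub>m Z_mat l e d G H) ^\<^sub>m n) = c ^ n *
    (\<Sum>a\<in>Fd. \<Sum>a'\<in>Fd. \<Sum>s\<in>Fl. \<Sum>s'\<in>Fl. \<Sum>t\<in>Fl. \<Sum>t'\<in>Fl. \<Sum>x\<in>Fd. \<Sum>x'\<in>Fd.
      (\<Prod>k\<in>{1..n}. overlap l e (s k) (s' k)) * cnj (\<Prod>k\<in>{1..n}. overlap l e (t k) (t' k)) *
      ((\<Prod>k\<in>{1..n}. G $$ (a k * d + x k, s k) * cnj (G $$ (a (long_cycle n k) * d + x k, t k))) *
       (\<Prod>k\<in>{1..n}. H $$ (a' k * d + x' k, s' k) * cnj (H $$ (a' (long_cycle n k) * d + x' k, t' k)))))"
proof -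
  let ?Z = "Z_mat l e d G H"
  have fin: "finite {..<m}" for m :: nat by simp
  have I: "finite {1..n}" by simp
  have "mat_trace ((c \<cdot>\<^sub>m ?Z) ^\<^sub>m n) = (\<Sum>p\<in>PiE {1..n} (\<lambda>_. {..<d * d}). \<Prod>k\<in>{1..n}. (c \<cdot>\<^sub>m ?Z) $$ (p k, p (long_cycle n k)))"
    using Z_mat_carrier n by (intro mat_trace_pow smult_carrier_mat)
  also have "\<dots> = (\<Sum>p\<in>PiE {1..n} (\<lambda>_. {..<d * d}). c ^ n * (\<Prod>k\<in>{1..n}. ?Z $$ (p k, p (long_cycle n k))))"
  proof (rule sum.cong[OF refl])
    fix p assume p: "p \<in> PiE {1..n} (\<lambda>_. {..<d * d})"
    have "(\<Prod>k\<in>{1..n}. (c \<cdot>\<^sub>m ?Z) $$ (p k, p (long_cycle n k))) = (\<Prod>k\<in>{1..n}. c * ?Z $$ (p k, p (long_cycle n k)))"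
    proof (rule prod.cong[OF refl])
      fix k assume k: "k \<in> {1..n}"
      then have "p k < d * d" "p (long_cycle n k) < d * d" using p long_cycle_in[OF k] by auto
      then show "(c \<cdot>\<^sub>m ?Z) $$ (p k, p (long_cycle n k)) = c * ?Z $$ (p k, p (long_cycle n k))"
        using Z_mat_carrier[of l e d G H] by simp
    qed
    then show "(\<Prod>k\<in>{1..n}. (c \<cdot>\<^sub>m ?Z) $$ (p k, p (long_cycle n k))) = c ^ n * (\<Prod>k\<in>{1..n}. ?Z $$ (p k, p (long_cycle n k)))"
      by (simp add: prod.distrib)
  qed
  also have "\<dots> = c ^ n * (\<Sum>a\<in>Fd. \<Sum>a'\<in>Fd. \<Prod>k\<in>{1..n}.
      ?Z $$ ((\<lambda>k\<in>{1..n}. a k * d + a' k) k, (\<lambda>k\<in>{1..n}. a k * d + a' k) (long_cycle n k)))"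
    unfolding sum_distrib_left[symmetric] sum_PiE_mult Fd_def ..
  also have "(\<Sum>a\<in>Fd. \<Sum>a'\<in>Fd. \<Prod>k\<in>{1..n}.
      ?Z $$ ((\<lambda>k\<in>{1..n}. a k * d + a' k) k, (\<lambda>k\<in>{1..n}. a k * d + a' k) (long_cycle n k))) =
    (\<Sum>a\<in>Fd. \<Sum>a'\<in>Fd. \<Sum>s\<in>Fl. \<Sum>s'\<in>Fl. \<Sum>t\<in>Fl. \<Sum>t'\<in>Fl. \<Sum>x\<in>Fd. \<Sum>x'\<in>Fd.
      (\<Prod>k\<in>{1..n}. overlap l e (s k) (s' k)) * cnj (\<Prod>k\<in>{1..n}. overlap l e (t k) (t' k)) *
      ((\<Prod>k\<in>{1..n}. G $$ (a k * d + x k, s k) * cnj (G $$ (a (long_cycle n k) * d + x k, t k))) *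
       (\<Prod>k\<in>{1..n}. H $$ (a' k * d + x' k, s' k) * cnj (H $$ (a' (long_cycle n k) * d + x' k, t' k)))))"
  proof (intro sum.cong refl)
    fix a a' assume a: "a \<in> Fd" and a': "a' \<in> Fd"
    have "(\<Prod>k\<in>{1..n}. ?Z $$ ((\<lambda>k\<in>{1..n}. a k * d + a' k) k, (\<lambda>k\<in>{1..n}. a k * d + a' k) (long_cycle n k))) =
      (\<Prod>k\<in>{1..n}. \<Sum>s<l. \<Sum>s'<l. \<Sum>t<l. \<Sum>t'<l. \<Sum>x<d. \<Sum>x'<d.
      (overlap l e s s' * cnj (overlap l e t t')) *
      (G $$ (a k * d + x, s) * cnj (G $$ (a (long_cycle n k) * d + x, t))) *
      (H $$ (a' k * d + x', s') * cnj (H $$ (a' (long_cycle n k) * d + x', t'))))"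
    proof (rule prod.cong[OF refl])
      fix k assume k: "k \<in> {1..n}"
      note g = long_cycle_in[OF k]
      have lt: "a k < d" "a (long_cycle n k) < d" "a' k < d" "a' (long_cycle n k) < d"
        using a a' k g unfolding Fd_def by auto
      show "?Z $$ ((\<lambda>k\<in>{1..n}. a k * d + a' k) k, (\<lambda>k\<in>{1..n}. a k * d + a' k) (long_cycle n k)) =
         (\<Sum>s<l. \<Sum>s'<l. \<Sum>t<l. \<Sum>t'<l. \<Sum>x<d. \<Sum>x'<d.
      (overlap l e s s' * cnj (overlap l e t t')) *
      (G $$ (a k * d + x, s) * cnj (G $$ (a (long_cycle n k) * d + x, t))) *
      (H $$ (a' k * d + x', s') * cnj (H $$ (a' (long_cycle n k) * d + x', t'))))"
        unfolding restrict_apply'[OF k] restrict_apply'[OF g] by (rule Z_mat_entry[OF e G H lt])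
    qed
    also have "\<dots> = (\<Sum>s\<in>Fl. \<Sum>s'\<in>Fl. \<Sum>t\<in>Fl. \<Sum>t'\<in>Fl. \<Sum>x\<in>Fd. \<Sum>x'\<in>Fd. \<Prod>k\<in>{1..n}.
      (overlap l e (s k) (s' k) * cnj (overlap l e (t k) (t' k))) *
      (G $$ (a k * d + x k, s k) * cnj (G $$ (a (long_cycle n k) * d + x k, t k))) *
      (H $$ (a' k * d + x' k, s' k) * cnj (H $$ (a' (long_cycle n k) * d + x' k, t' k))))"
      unfolding Fd_def Fl_def by (simp only: prod_sum_PiE[OF I fin])
    finally show "(\<Prod>k\<in>{1..n}. ?Z $$ ((\<lambda>k\<in>{1..n}. a k * d + a' k) k, (\<lambda>k\<in>{1..n}. a k * d + a' k) (long_cycle n k))) =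
      (\<Sum>s\<in>Fl. \<Sum>s'\<in>Fl. \<Sum>t\<in>Fl. \<Sum>t'\<in>Fl. \<Sum>x\<in>Fd. \<Sum>x'\<in>Fd.
      (\<Prod>k\<in>{1..n}. overlap l e (s k) (s' k)) * cnj (\<Prod>k\<in>{1..n}. overlap l e (t k) (t' k)) *
      ((\<Prod>k\<in>{1..n}. G $$ (a k * d + x k, s k) * cnj (G $$ (a (long_cycle n k) * d + x k, t k))) *
       (\<Prod>k\<in>{1..n}. H $$ (a' k * d + x' k, s' k) * cnj (H $$ (a' (long_cycle n k) * d + x' k, t' k)))))"
      by (simp only: prod.distrib cnj_prod mult.assoc)
  qed
  finally show ?thesis .
qed

section \<open>The moment formula\<close>

text \<open>An invariant function is a free choice of one value for each cycle.\<close>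

lemma card_invariant_functions:
  assumes s: "s permutes {1..n}"
  shows "card {f \<in> PiE {1..n} (\<lambda>_. {..<d}). \<forall>k\<in>{1..n}. f (s k) = f k} = d ^ num_cycles n s"
proof -
  let ?I = "{1..n}" and ?O = "orbit s ` {1..n}"
  let ?F = "{f \<in> PiE ?I (\<lambda>_. {..<d}). \<forall>k\<in>?I. f (s k) = f k}"
  note ps = permutation_of_permutes_nat[OF s]
  have step: "orbit s (s k) = orbit s k" for k by (rule permutation_orbit_step[OF ps])
  have sI: "s k \<in> ?I \<longleftrightarrow> k \<in> ?I" for k by (rule permutes_in_image[OF s])
  have "bij_betw (\<lambda>g. \<lambda>k\<in>?I. g (orbit s k)) (PiE ?O (\<lambda>_. {..<d})) ?F"
    unfolding bij_betw_def
  proof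
    show "inj_on (\<lambda>g. \<lambda>k\<in>?I. g (orbit s k)) (PiE ?O (\<lambda>_. {..<d}))"
    proof (rule inj_onI)
      fix g h assume g: "g \<in> PiE ?O (\<lambda>_. {..<d})" and h: "h \<in> PiE ?O (\<lambda>_. {..<d})"
        and e: "(\<lambda>k\<in>?I. g (orbit s k)) = (\<lambda>k\<in>?I. h (orbit s k))"
      have "g (orbit s k) = h (orbit s k)" if "k \<in> ?I" for k
        using fun_cong[OF e, of k] that by (simp only: restrict_apply')
      then show "g = h" by (intro PiE_ext[OF g h]) auto
    qed
    show "(\<lambda>g. \<lambda>k\<in>?I. g (orbit s k)) ` PiE ?O (\<lambda>_. {..<d}) = ?F"
    proof (intro equalityI subsetI)
      fix f assume "f \<in> (\<lambda>g. \<lambda>k\<in>?I. g (orbit s k)) ` PiE ?O (\<lambda>_. {..<d})"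
      then obtain g where g: "g \<in> PiE ?O (\<lambda>_. {..<d})" and f: "f = (\<lambda>k\<in>?I. g (orbit s k))" by auto
      have "f \<in> PiE ?I (\<lambda>_. {..<d})" unfolding f using g by auto
      moreover have "f (s k) = f k" if "k \<in> ?I" for k
        unfolding f restrict_apply'[OF that] restrict_apply'[OF sI[THEN iffD2, OF that]] step ..
      ultimately show "f \<in> ?F" by blast
    next
      fix f assume "f \<in> ?F"
      then have f: "f \<in> PiE ?I (\<lambda>_. {..<d})" and inv: "\<And>k. k \<in> ?I \<Longrightarrow> f (s k) = f k" by auto
      have const: "f y = f x" if "x \<in> ?I" "y \<in> orbit s x" for x y
        using that(2)
      proof induction
        case base
        show ?case by (rule inv[OF that(1)])
      next
        case (step z)
        then have "z \<in> ?I" using permutes_orbit_subset[OF s that(1)] by blast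
        then show ?case using inv step by simp
      qed
      \<comment> \<open>The choice of representative does not matter, since \<open>f\<close> is
        constant on each orbit by \<open>const\<close>.\<close>
      define g where "g = (\<lambda>A\<in>?O. f (SOME k. k \<in> A))"
      have g: "g (orbit s k) = f k" if "k \<in> ?I" for k
      proof -
        have "(SOME j. j \<in> orbit s k) \<in> orbit s k" by (rule someI, rule orbit.base)
        then show ?thesis using const[OF that] that unfolding g_def by simp
      qed
      have "g \<in> PiE ?O (\<lambda>_. {..<d})"
      proof (rule PiE_I)
        fix A assume "A \<in> ?O"
        then obtain k where k: "k \<in> ?I" "A = orbit s k" by auto
        show "g A \<in> {..<d}" unfolding k(2) g[OF k(1)] using f k(1) by auto
      qed (simp add: g_def)
      moreover have "f = (\<lambda>k\<in>?I. g (orbit s k))"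
      proof
        fix k show "f k = (\<lambda>k\<in>?I. g (orbit s k)) k"
          using g[of k] f by (cases "k \<in> ?I") (auto simp: PiE_def extensional_def)
      qed
      ultimately show "f \<in> (\<lambda>g. \<lambda>k\<in>?I. g (orbit s k)) ` PiE ?O (\<lambda>_. {..<d})" by (intro image_eqI[where x = g])
    qed
  qed
  then have "card ?F = card (PiE ?O (\<lambda>_. {..<d}))" by (simp add: bij_betw_same_card)
  also have "\<dots> = d ^ num_cycles n s" by (simp add: card_PiE num_cycles_def)
  finally show ?thesis .
qed

lemma sum_of_bool_card:
  "finite A \<Longrightarrow> (\<Sum>x\<in>A. of_bool (Q x)) = (of_nat (card {x\<in>A. Q x}) :: complex)"
  by (simp add: sum_of_bool_eq Int_def)

lemma prod_indicator:
  "finite I \<Longrightarrow> (\<Prod>k\<in>I. if Q k then 1 else 0) = (of_bool (\<forall>k\<in>I. Q k) :: complex)"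
  by (induction I rule: finite_induct) auto

lemma finite_PiE_lessThan: "finite (PiE {1..n::nat} (\<lambda>_. {..<d::nat}))"
  by (intro finite_PiE) auto

lemma num_cycles_comp_inv:
  assumes a: "a permutes {1..n}" and b: "b permutes {1..n}"
  shows "num_cycles n (b \<circ> Hilbert_Choice.inv a) = num_cycles n (Hilbert_Choice.inv a \<circ> b)"
proof -
  have "a \<circ> (Hilbert_Choice.inv a \<circ> b) \<circ> Hilbert_Choice.inv a = b \<circ> Hilbert_Choice.inv a"
    using permutes_inv_o(1)[OF a] by (simp add: comp_assoc[symmetric] del: comp_apply)
  moreover have "Hilbert_Choice.inv a \<circ> b permutes {1..n}" by (intro permutes_compose b permutes_inv a)
  ultimately show ?thesis
    using num_cycles_conj[OF permutes_bij[OF a] permutes_image[OF a] permutation_of_permutes_nat] by metis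
qed

lemma sum_invariant:
  assumes "s permutes {1..n}"
  shows "(\<Sum>x\<in>PiE {1..n} (\<lambda>_. {..<d}). of_bool (\<forall>k\<in>{1..n}. x (s k) = x k)) = (of_nat d ^ num_cycles n s :: complex)"
  unfolding sum_of_bool_card[OF finite_PiE_lessThan] card_invariant_functions[OF assms] by simp

text \<open>Substituting the predecessor of \<open>k\<close> turns the condition into invariance
  under \<open>s \<circ> inv (long_cycle n)\<close>, which is conjugate to
  \<open>kreweras n s\<close>.\<close>

lemma sum_long_cycle_invariant:
  assumes s: "s permutes {1..n}"
  shows "(\<Sum>a\<in>PiE {1..n} (\<lambda>_. {..<d}). of_bool (\<forall>k\<in>{1..n}. a (s k) = a (long_cycle n k))) =
    (of_nat d ^ num_cycles n (kreweras n s) :: complex)"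
proof -
  let ?g = "Hilbert_Choice.inv (long_cycle n)"
  have g: "?g permutes {1..n}" by (intro permutes_inv long_cycle_permutes)
  have "(\<forall>k\<in>{1..n}. a (s k) = a (long_cycle n k)) \<longleftrightarrow> (\<forall>k\<in>{1..n}. a ((s \<circ> ?g) k) = a k)" for a :: "nat \<Rightarrow> nat"
  proof
    assume l: "\<forall>k\<in>{1..n}. a (s k) = a (long_cycle n k)"
    show "\<forall>k\<in>{1..n}. a ((s \<circ> ?g) k) = a k"
    proof
      fix k assume "k \<in> {1..n}"
      then have "?g k \<in> {1..n}" by (simp only: permutes_in_image[OF g])
      then have "a (s (?g k)) = a (long_cycle n (?g k))" using l by blast
      then show "a ((s \<circ> ?g) k) = a k" by (simp add: surj_f_inv_f[OF bij_is_surj[OF bij_long_cycle]])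
    qed
  next
    assume r: "\<forall>k\<in>{1..n}. a ((s \<circ> ?g) k) = a k"
    show "\<forall>k\<in>{1..n}. a (s k) = a (long_cycle n k)"
    proof
      fix k assume "k \<in> {1..n}"
      then have "long_cycle n k \<in> {1..n}" by (rule long_cycle_in)
      then have "a ((s \<circ> ?g) (long_cycle n k)) = a (long_cycle n k)" using r by blast
      then show "a (s k) = a (long_cycle n k)" by (simp add: inv_f_f[OF bij_is_inj[OF bij_long_cycle]])
    qed
  qed
  then have "(\<Sum>a\<in>PiE {1..n} (\<lambda>_. {..<d}). of_bool (\<forall>k\<in>{1..n}. a (s k) = a (long_cycle n k))) =
     (of_nat d ^ num_cycles n (s \<circ> ?g) :: complex)"
    using sum_invariant[OF permutes_compose[OF g s], of d] by (simp del: comp_apply)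
  then show ?thesis unfolding kreweras_def num_cycles_comp_inv[OF long_cycle_permutes s] .
qed

text \<open>Reindexing the conjugated product by the inverse of \<open>a\<close> puts the same
  \<open>s k\<close> into both factors. Unitarity sums out \<open>s\<close> and forces
  \<open>s'\<close> to be invariant under \<open>b \<circ> inv a\<close>.\<close>

lemma sum_overlap:
  assumes e: "orthonormal_basis l e" and a: "a permutes {1..n}" and b: "b permutes {1..n}"
  defines "Fl \<equiv> PiE {1..n} (\<lambda>_. {..<l})"
  shows "(\<Sum>s\<in>Fl. \<Sum>s'\<in>Fl. (\<Prod>k\<in>{1..n}. overlap l e (s k) (s' k)) *
      cnj (\<Prod>k\<in>{1..n}. overlap l e (s (a k)) (s' (b k)))) =
    of_nat l ^ num_cycles n (Hilbert_Choice.inv a \<circ> b)"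
proof -
  let ?I = "{1..n}" and ?t = "b \<circ> Hilbert_Choice.inv a"
  have t: "?t permutes ?I" by (intro permutes_compose b permutes_inv a)
  have ia: "Hilbert_Choice.inv a (a k) = k" for k by (rule permutes_inverses(2)[OF a])
  have "(\<Sum>s\<in>Fl. \<Sum>s'\<in>Fl. (\<Prod>k\<in>?I. overlap l e (s k) (s' k)) * cnj (\<Prod>k\<in>?I. overlap l e (s (a k)) (s' (b k)))) =
    (\<Sum>s\<in>Fl. \<Sum>s'\<in>Fl. \<Prod>k\<in>?I. overlap l e (s k) (s' k) * cnj (overlap l e (s k) (s' (?t k))))"
  proof (intro sum.cong refl)
    fix s s'
    have eq: "(\<Prod>k\<in>?I. overlap l e (s k) (s' (?t k))) = (\<Prod>k\<in>?I. overlap l e (s (a k)) (s' (b k)))"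
      using prod.permute[OF a, of "\<lambda>k. overlap l e (s k) (s' (?t k))"] by (simp add: ia)
    show "(\<Prod>k\<in>?I. overlap l e (s k) (s' k)) * cnj (\<Prod>k\<in>?I. overlap l e (s (a k)) (s' (b k))) =
       (\<Prod>k\<in>?I. overlap l e (s k) (s' k) * cnj (overlap l e (s k) (s' (?t k))))"
      unfolding eq[symmetric] by (simp only: prod.distrib cnj_prod)
  qed
  also have "\<dots> = (\<Sum>s'\<in>Fl. \<Sum>s\<in>Fl. \<Prod>k\<in>?I. overlap l e (s k) (s' k) * cnj (overlap l e (s k) (s' (?t k))))"
    by (rule sum.swap)
  also have "\<dots> = (\<Sum>s'\<in>Fl. \<Prod>k\<in>?I. \<Sum>i<l. overlap l e i (s' k) * cnj (overlap l e i (s' (?t k))))"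
    unfolding Fl_def by (intro sum.cong refl prod_sum_PiE[symmetric]) auto
  also have "\<dots> = (\<Sum>s'\<in>Fl. \<Prod>k\<in>?I. if s' (?t k) = s' k then 1 else 0)"
  proof (intro sum.cong prod.cong refl)
    fix s' k assume s': "s' \<in> Fl" and k: "k \<in> ?I"
    have "?t k \<in> ?I" using k by (simp only: permutes_in_image[OF t])
    then have "s' k < l" "s' (?t k) < l" using s' k unfolding Fl_def by (auto simp del: comp_apply)
    then show "(\<Sum>i<l. overlap l e i (s' k) * cnj (overlap l e i (s' (?t k)))) =
       (if s' (?t k) = s' k then 1 else 0)"
      unfolding eq_commute[of "s' (?t k)" "s' k"] by (rule overlap_unitary[OF e])
  qed
  also have "\<dots> = (\<Sum>s'\<in>Fl. of_bool (\<forall>k\<in>?I. s' (?t k) = s' k))"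
    by (intro sum.cong refl prod_indicator) auto
  also have "\<dots> = of_nat l ^ num_cycles n ?t"
    unfolding Fl_def by (rule sum_invariant[OF t])
  finally show ?thesis unfolding num_cycles_comp_inv[OF a b] .
qed

lemma sum_swap_product:
  fixes f g :: "'a \<Rightarrow> 'b \<Rightarrow> 'c :: comm_semiring_1"
  shows "(\<Sum>a\<in>A. \<Sum>a'\<in>A. \<Sum>x\<in>B. \<Sum>x'\<in>B. c * (f a x * g a' x')) =
    c * ((\<Sum>a\<in>A. \<Sum>x\<in>B. f a x) * (\<Sum>a\<in>A. \<Sum>x\<in>B. g a x))"
  by (simp only: sum_distrib_left[symmetric] sum_distrib_right[symmetric])

lemma sum_swap4:
  "(\<Sum>a\<in>A. \<Sum>a'\<in>A. \<Sum>s\<in>B. \<Sum>s'\<in>B. \<Sum>t\<in>B. \<Sum>t'\<in>B. h a a' s s' t t') =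
   (\<Sum>s\<in>B. \<Sum>s'\<in>B. \<Sum>t\<in>B. \<Sum>t'\<in>B. \<Sum>a\<in>A. \<Sum>a'\<in>A. h a a' s s' t t')"
  by (simp only: sum.swap[of _ B A])

lemma sum_swap2:
  "(\<Sum>s\<in>B. \<Sum>s'\<in>B. \<Sum>t\<in>B. \<Sum>t'\<in>B. \<Sum>a\<in>A. \<Sum>b\<in>A. h a b s s' t t') =
   (\<Sum>a\<in>A. \<Sum>b\<in>A. \<Sum>s\<in>B. \<Sum>s'\<in>B. \<Sum>t\<in>B. \<Sum>t'\<in>B. h a b s s' t t')"
  by (simp only: sum.swap[of _ A B])

lemma sum_delta_restrict:
  fixes f :: "(nat \<Rightarrow> nat) \<Rightarrow> complex"
  assumes "r \<in> PiE {1..n} (\<lambda>_. {..<l})" "a permutes {1..n}"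
  shows "(\<Sum>t\<in>PiE {1..n} (\<lambda>_. {..<l}). f t * of_bool (\<forall>k\<in>{1..n}. r (a k) = t k)) = f (\<lambda>k\<in>{1..n}. r (a k))"
proof -
  let ?r = "\<lambda>k\<in>{1..n}. r (a k)"
  have aI: "a k \<in> {1..n}" if "k \<in> {1..n}" for k using that by (simp only: permutes_in_image[OF assms(2)])
  have r: "?r \<in> PiE {1..n} (\<lambda>_. {..<l})" using assms(1) aI by (auto simp: PiE_def Pi_def)
  have "(\<Sum>t\<in>PiE {1..n} (\<lambda>_. {..<l}). f t * of_bool (\<forall>k\<in>{1..n}. r (a k) = t k)) =
    (\<Sum>t\<in>PiE {1..n} (\<lambda>_. {..<l}). if t = ?r then f t else 0)"
  proof (rule sum.cong[OF refl])
    fix t assume t: "t \<in> PiE {1..n} (\<lambda>_. {..<l})"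
    have "(\<forall>k\<in>{1..n}. r (a k) = t k) \<longleftrightarrow> t = ?r"
    proof
      assume "\<forall>k\<in>{1..n}. r (a k) = t k"
      then show "t = ?r" by (intro PiE_ext[OF t r]) simp
    qed simp
    then show "f t * of_bool (\<forall>k\<in>{1..n}. r (a k) = t k) = (if t = ?r then f t else 0)" by simp
  qed
  also have "\<dots> = f ?r" using r finite_PiE_lessThan by (simp add: sum.delta)
  finally show ?thesis .
qed

text \<open>\<open>N\<close> is the Wick count for one Ginibre matrix, split by kind of label. The
  sums over \<open>a\<close> and \<open>x\<close> give the powers of \<open>d\<close>, the
  indicators eliminate \<open>t\<close> and \<open>t'\<close>, and \<open>sum_overlap\<close>
  evaluates the rest.\<close>

lemma sum_contract:
  fixes l n d :: nat
  assumes e: "orthonormal_basis l e" 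
  defines "Fd \<equiv> PiE {1..n} (\<lambda>_. {..<d})" and "Fl \<equiv> PiE {1..n} (\<lambda>_. {..<l})"
    and "N \<equiv> \<lambda>a x s t. \<Sum>p | p permutes {1..n}. of_bool (\<forall>k\<in>{1..n}. a (p k) = a (long_cycle n k)) *
      of_bool (\<forall>k\<in>{1..n}. x (p k) = x k) * of_bool (\<forall>k\<in>{1..n}. s (p k) = t k)"
    and "C \<equiv> \<lambda>p. of_nat d ^ (num_cycles n p + num_cycles n (kreweras n p))"
  shows "(\<Sum>a\<in>Fd. \<Sum>a'\<in>Fd. \<Sum>s\<in>Fl. \<Sum>s'\<in>Fl. \<Sum>t\<in>Fl. \<Sum>t'\<in>Fl. \<Sum>x\<in>Fd. \<Sum>x'\<in>Fd.
      (\<Prod>k\<in>{1..n}. overlap l e (s k) (s' k)) * cnj (\<Prod>k\<in>{1..n}. overlap l e (t k) (t' k)) *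
      (N a x s t * N a' x' s' t')) =
    (\<Sum>p | p permutes {1..n}. \<Sum>q | q permutes {1..n}. C p * C q *
       of_nat l ^ num_cycles n (Hilbert_Choice.inv p \<circ> q))"
proof -
  let ?P = "{p. p permutes {1..n}}"
  define w where "w s t = (\<Prod>k\<in>{1..n}. overlap l e (s k) (t k))" for s t :: "nat \<Rightarrow> nat"
  define E where "E s t p = (of_bool (\<forall>k\<in>{1..n}. s (p k) = t k) :: complex)" for s t p :: "nat \<Rightarrow> nat"
  have N: "(\<Sum>a\<in>Fd. \<Sum>x\<in>Fd. N a x s t) = (\<Sum>p\<in>?P. C p * E s t p)" for s t
  proof -
    have "(\<Sum>a\<in>Fd. \<Sum>x\<in>Fd. N a x s t) = (\<Sum>p\<in>?P. \<Sum>a\<in>Fd. \<Sum>x\<in>Fd.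
      of_bool (\<forall>k\<in>{1..n}. a (p k) = a (long_cycle n k)) * of_bool (\<forall>k\<in>{1..n}. x (p k) = x k) * E s t p)"
      unfolding N_def E_def by (simp only: sum.swap[of _ ?P Fd])
    also have "\<dots> = (\<Sum>p\<in>?P. (\<Sum>a\<in>Fd. of_bool (\<forall>k\<in>{1..n}. a (p k) = a (long_cycle n k))) *
       (\<Sum>x\<in>Fd. of_bool (\<forall>k\<in>{1..n}. x (p k) = x k)) * E s t p)"
      by (simp only: sum_distrib_left[symmetric] sum_distrib_right[symmetric])
    also have "\<dots> = (\<Sum>p\<in>?P. C p * E s t p)"
    proof (rule sum.cong[OF refl])
      fix p assume "p \<in> ?P"
      then have p: "p permutes {1..n}" by simp
      show "(\<Sum>a\<in>Fd. of_bool (\<forall>k\<in>{1..n}. a (p k) = a (long_cycle n k))) *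
         (\<Sum>x\<in>Fd. of_bool (\<forall>k\<in>{1..n}. x (p k) = x k)) * E s t p = C p * E s t p"
        unfolding Fd_def sum_invariant[OF p] sum_long_cycle_invariant[OF p] C_def
        by (simp add: power_add mult.commute)
    qed
    finally show ?thesis .
  qed
  \<comment> \<open>For fixed labels below \<open>l\<close>, the sums over labels below
    \<open>d\<close> factor into one part for \<open>G\<close> and one for \<open>H\<close>.\<close>
  have "(\<Sum>a\<in>Fd. \<Sum>a'\<in>Fd. \<Sum>s\<in>Fl. \<Sum>s'\<in>Fl. \<Sum>t\<in>Fl. \<Sum>t'\<in>Fl. \<Sum>x\<in>Fd. \<Sum>x'\<in>Fd.
      w s s' * cnj (w t t') * (N a x s t * N a' x' s' t')) =
    (\<Sum>s\<in>Fl. \<Sum>s'\<in>Fl. \<Sum>t\<in>Fl. \<Sum>t'\<in>Fl. w s s' * cnj (w t t') *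
       ((\<Sum>a\<in>Fd. \<Sum>x\<in>Fd. N a x s t) * (\<Sum>a\<in>Fd. \<Sum>x\<in>Fd. N a x s' t')))"
    unfolding sum_swap4 sum_swap_product ..
  also have "\<dots> = (\<Sum>s\<in>Fl. \<Sum>s'\<in>Fl. \<Sum>t\<in>Fl. \<Sum>t'\<in>Fl. \<Sum>p\<in>?P. \<Sum>q\<in>?P. w s s' * cnj (w t t') *
       ((C p * E s t p) * (C q * E s' t' q)))"
    unfolding N sum_product by (simp only: sum_distrib_left)
  also have "\<dots> = (\<Sum>p\<in>?P. \<Sum>q\<in>?P. \<Sum>s\<in>Fl. \<Sum>s'\<in>Fl. \<Sum>t\<in>Fl. \<Sum>t'\<in>Fl. w s s' * cnj (w t t') *
       ((C p * E s t p) * (C q * E s' t' q)))"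
    by (rule sum_swap2)
  also have "\<dots> = (\<Sum>p\<in>?P. \<Sum>q\<in>?P. C p * C q * of_nat l ^ num_cycles n (Hilbert_Choice.inv p \<circ> q))"
  proof (intro sum.cong refl)
    fix p q assume "p \<in> ?P" "q \<in> ?P"
    then have p: "p permutes {1..n}" and q: "q permutes {1..n}" by auto
    have "(\<Sum>s\<in>Fl. \<Sum>s'\<in>Fl. \<Sum>t\<in>Fl. \<Sum>t'\<in>Fl. w s s' * cnj (w t t') * ((C p * E s t p) * (C q * E s' t' q))) =
      (\<Sum>s\<in>Fl. \<Sum>s'\<in>Fl. C p * C q * (w s s' * cnj (w (\<lambda>k\<in>{1..n}. s (p k)) (\<lambda>k\<in>{1..n}. s' (q k)))))"
    proof (intro sum.cong refl)
      fix s s' assume s: "s \<in> Fl" and s': "s' \<in> Fl"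
      have "(\<Sum>t\<in>Fl. \<Sum>t'\<in>Fl. w s s' * cnj (w t t') * ((C p * E s t p) * (C q * E s' t' q))) =
        (\<Sum>t\<in>Fl. (\<Sum>t'\<in>Fl. (C p * C q * w s s' * cnj (w t t')) * E s' t' q) * E s t p)"
        unfolding sum_distrib_right by (intro sum.cong refl) (simp add: mult_ac)
      also have "\<dots> = (\<Sum>t\<in>Fl. (C p * C q * w s s' * cnj (w t (\<lambda>k\<in>{1..n}. s' (q k)))) * E s t p)"
        using sum_delta_restrict[OF s'[unfolded Fl_def] q] unfolding Fl_def E_def by simp
      also have "\<dots> = C p * C q * w s s' * cnj (w (\<lambda>k\<in>{1..n}. s (p k)) (\<lambda>k\<in>{1..n}. s' (q k)))"
        using sum_delta_restrict[OF s[unfolded Fl_def] p] unfolding Fl_def E_def .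
      finally show "(\<Sum>t\<in>Fl. \<Sum>t'\<in>Fl. w s s' * cnj (w t t') * ((C p * E s t p) * (C q * E s' t' q))) =
         C p * C q * (w s s' * cnj (w (\<lambda>k\<in>{1..n}. s (p k)) (\<lambda>k\<in>{1..n}. s' (q k))))" by (simp only: mult.assoc)
    qed
    also have "\<dots> = C p * C q * (\<Sum>s\<in>Fl. \<Sum>s'\<in>Fl. w s s' * cnj (w (\<lambda>k\<in>{1..n}. s (p k)) (\<lambda>k\<in>{1..n}. s' (q k))))"
      by (simp only: sum_distrib_left)
    also have "(\<Sum>s\<in>Fl. \<Sum>s'\<in>Fl. w s s' * cnj (w (\<lambda>k\<in>{1..n}. s (p k)) (\<lambda>k\<in>{1..n}. s' (q k)))) =
       of_nat l ^ num_cycles n (Hilbert_Choice.inv p \<circ> q)"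
      using sum_overlap[OF e p q] unfolding w_def Fl_def by simp
    finally show "(\<Sum>s\<in>Fl. \<Sum>s'\<in>Fl. \<Sum>t\<in>Fl. \<Sum>t'\<in>Fl. w s s' * cnj (w t t') * ((C p * E s t p) * (C q * E s' t' q))) =
       C p * C q * of_nat l ^ num_cycles n (Hilbert_Choice.inv p \<circ> q)" .
  qed
  finally show ?thesis unfolding w_def .
qed

text \<open>Since \<open>x k < d\<close>, the row index determines both of its digits, so matching
  two entries means matching three labels separately.\<close>

lemma card_wick_labels:
  fixes n d :: nat and a x s t :: "nat \<Rightarrow> nat"
  assumes a: "a \<in> PiE {1..n} (\<lambda>_. {..<d})" and x: "x \<in> PiE {1..n} (\<lambda>_. {..<d})"
  shows "(of_nat (card {p. p permutes {1..n} \<and>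
      (\<forall>k\<in>{1..n}. (a (p k) * d + x (p k), s (p k)) = (a (long_cycle n k) * d + x k, t k))}) :: complex) =
    (\<Sum>p | p permutes {1..n}. of_bool (\<forall>k\<in>{1..n}. a (p k) = a (long_cycle n k)) *
      of_bool (\<forall>k\<in>{1..n}. x (p k) = x k) * of_bool (\<forall>k\<in>{1..n}. s (p k) = t k))"
proof -
  have fin: "finite {p. p permutes {1..n}}" by (intro finite_permutations) simp
  have eq: "u * d + v = u' * d + v' \<longleftrightarrow> u = u' \<and> v = v'" if "v < d" "v' < d" for u v u' v' :: nat
  proof
    assume h: "u * d + v = u' * d + v'"
    have "(u * d + v) div d = u" "(u' * d + v') div d = u'" using that by auto
    then show "u = u' \<and> v = v'" using h by auto
  qed simp
  have "(of_nat (card {p. p permutes {1..n} \<and>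
      (\<forall>k\<in>{1..n}. (a (p k) * d + x (p k), s (p k)) = (a (long_cycle n k) * d + x k, t k))}) :: complex) =
     (\<Sum>p | p permutes {1..n}. of_bool (\<forall>k\<in>{1..n}. (a (p k) * d + x (p k), s (p k)) = (a (long_cycle n k) * d + x k, t k)))"
    unfolding sum_of_bool_card[OF fin] by simp
  also have "\<dots> = (\<Sum>p | p permutes {1..n}. of_bool (\<forall>k\<in>{1..n}. a (p k) = a (long_cycle n k)) *
      of_bool (\<forall>k\<in>{1..n}. x (p k) = x k) * of_bool (\<forall>k\<in>{1..n}. s (p k) = t k))"
  proof (rule sum.cong[OF refl])
    fix p assume "p \<in> {p. p permutes {1..n}}"
    then have p: "p permutes {1..n}" by simp
    have "(a (p k) * d + x (p k), s (p k)) = (a (long_cycle n k) * d + x k, t k) \<longleftrightarrow>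
       a (p k) = a (long_cycle n k) \<and> x (p k) = x k \<and> s (p k) = t k" if "k \<in> {1..n}" for k
    proof -
      have "p k \<in> {1..n}" using that by (simp only: permutes_in_image[OF p])
      then have "x (p k) < d" "x k < d" using x that by auto
      from eq[OF this] show ?thesis by simp
    qed
    then have "(\<forall>k\<in>{1..n}. (a (p k) * d + x (p k), s (p k)) = (a (long_cycle n k) * d + x k, t k)) \<longleftrightarrow>
      (\<forall>k\<in>{1..n}. a (p k) = a (long_cycle n k)) \<and> (\<forall>k\<in>{1..n}. x (p k) = x k) \<and> (\<forall>k\<in>{1..n}. s (p k) = t k)"
      by blast
    then show "of_bool (\<forall>k\<in>{1..n}. (a (p k) * d + x (p k), s (p k)) = (a (long_cycle n k) * d + x k, t k)) =
      (of_bool (\<forall>k\<in>{1..n}. a (p k) = a (long_cycle n k)) *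
      of_bool (\<forall>k\<in>{1..n}. x (p k) = x k) * of_bool (\<forall>k\<in>{1..n}. s (p k) = t k) :: complex)" by simp
  qed
  finally show ?thesis .
qed

section \<open>Expectations over the two Ginibre matrices\<close>

context prob_space
begin

lemma ginibre_wick:
  assumes G: "ginibre M r c G" and A: "finite A" and uv: "u ` A \<subseteq> {..<r} \<times> {..<c}" "v ` A \<subseteq> {..<r} \<times> {..<c}"
  shows "integrable M (\<lambda>w. \<Prod>k\<in>A. G w $$ u k * cnj (G w $$ v k))"
    and "expectation (\<lambda>w. \<Prod>k\<in>A. G w $$ u k * cnj (G w $$ v k)) =
      of_nat (card {s. s permutes A \<and> (\<forall>k\<in>A. u (s k) = v k)})"
  using wick[OF _ A uv, of "\<lambda>p w. G w $$ p"] G unfolding ginibre_def by auto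

text \<open>Each product is a measurable function of finitely many entries of one matrix, hence
  inherits independence from the pair of matrices.\<close>

lemma indep_random_mats_prod:
  fixes A :: "'k set"
  assumes ind: "indep_random_mats M r c G H"
    and uv: "u ` A \<subseteq> {..<r} \<times> {..<c}" "v ` A \<subseteq> {..<r} \<times> {..<c}"
      "u' ` A \<subseteq> {..<r} \<times> {..<c}" "v' ` A \<subseteq> {..<r} \<times> {..<c}"
  shows "indep_var borel (\<lambda>w. \<Prod>k\<in>A. G w $$ u k * cnj (G w $$ v k))
    borel (\<lambda>w. \<Prod>k\<in>A. H w $$ u' k * cnj (H w $$ v' k))"
proof -
  let ?J = "{..<r} \<times> {..<c}"
  have cnj_meas: "cnj \<in> borel_measurable borel"
    by (intro borel_measurable_continuous_onI continuous_intros)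
  have m: "(\<lambda>z. \<Prod>k\<in>A. z (f k) * cnj (z (g k))) \<in> borel_measurable (PiM ?J (\<lambda>_. borel))"
    if "f ` A \<subseteq> ?J" "g ` A \<subseteq> ?J" for f g :: "'k \<Rightarrow> nat \<times> nat"
  proof (intro borel_measurable_prod borel_measurable_times)
    fix k assume k: "k \<in> A"
    have fg: "f k \<in> ?J" "g k \<in> ?J" using that k by auto
    show "(\<lambda>z. z (f k)) \<in> borel_measurable (PiM ?J (\<lambda>_. borel))"
      by (rule measurable_component_singleton[OF fg(1)])
    show "(\<lambda>z. cnj (z (g k))) \<in> borel_measurable (PiM ?J (\<lambda>_. borel))"
      by (rule measurable_compose[OF measurable_component_singleton[OF fg(2)] cnj_meas])
  qed
  have r: "(\<lambda>z. \<Prod>k\<in>A. z (f k) * cnj (z (g k))) \<circ> (\<lambda>w. restrict (\<lambda>p. K w $$ p) ?J) =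
      (\<lambda>w. \<Prod>k\<in>A. K w $$ f k * cnj (K w $$ g k))"
    if "f ` A \<subseteq> ?J" "g ` A \<subseteq> ?J" for f g :: "'k \<Rightarrow> nat \<times> nat" and K :: "'a \<Rightarrow> complex Matrix.mat"
  proof
    fix w
    have "f k \<in> ?J" "g k \<in> ?J" if "k \<in> A" for k using \<open>f ` A \<subseteq> ?J\<close> \<open>g ` A \<subseteq> ?J\<close> that by auto
    then show "((\<lambda>z. \<Prod>k\<in>A. z (f k) * cnj (z (g k))) \<circ> (\<lambda>w. restrict (\<lambda>p. K w $$ p) ?J)) w =
       (\<Prod>k\<in>A. K w $$ f k * cnj (K w $$ g k))"
      unfolding comp_apply by (intro prod.cong refl) (simp only: restrict_apply')
  qed
  show ?thesis
    using indep_var_compose[OF ind[unfolded indep_random_mats_def] m[OF uv(1,2)] m[OF uv(3,4)]]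
    unfolding r[OF uv(1,2)] r[OF uv(3,4)] .
qed

lemma expectation_trace_Z_pow:
  assumes e: "orthonormal_basis l e" and G: "ginibre M (d * d) l G" and H: "ginibre M (d * d) l H"
    and ind: "indep_random_mats M (d * d) l G H" and n: "n \<ge> 1"
  defines "C \<equiv> \<lambda>p. of_nat d ^ (num_cycles n p + num_cycles n (kreweras n p))"
  shows "integrable M (\<lambda>w. mat_trace ((c \<cdot>\<^sub>m Z_mat l e d (G w) (H w)) ^\<^sub>m n))" (is ?int)
    and "expectation (\<lambda>w. mat_trace ((c \<cdot>\<^sub>m Z_mat l e d (G w) (H w)) ^\<^sub>m n)) = c ^ n *
      (\<Sum>p | p permutes {1..n}. \<Sum>q | q permutes {1..n}. C p * C q *
         of_nat l ^ num_cycles n (Hilbert_Choice.inv p \<circ> q))" (is ?exp)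
proof -
  define Fd where "Fd = PiE {1..n} (\<lambda>_. {..<d})"
  define Fl where "Fl = PiE {1..n} (\<lambda>_. {..<l})"
  define X where "X K a x s t w = (\<Prod>k\<in>{1..n}. K w $$ (a k * d + x k, s k) * cnj (K w $$ (a (long_cycle n k) * d + x k, t k)))"
    for K :: "'a \<Rightarrow> complex Matrix.mat" and a x s t w
  define V where "V s s' t t' = (\<Prod>k\<in>{1..n}. overlap l e (s k) (s' k)) * cnj (\<Prod>k\<in>{1..n}. overlap l e (t k) (t' k))"
    for s s' t t'
  define T where "T w = c ^ n * (\<Sum>a\<in>Fd. \<Sum>a'\<in>Fd. \<Sum>s\<in>Fl. \<Sum>s'\<in>Fl. \<Sum>t\<in>Fl. \<Sum>t'\<in>Fl. \<Sum>x\<in>Fd. \<Sum>x'\<in>Fd.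
      V s s' t t' * (X G a x s t w * X H a' x' s' t' w))" for w
  define N where "N a x s t = (\<Sum>p | p permutes {1..n}. of_bool (\<forall>k\<in>{1..n}. a (p k) = a (long_cycle n k)) *
      of_bool (\<forall>k\<in>{1..n}. x (p k) = x k) * of_bool (\<forall>k\<in>{1..n}. s (p k) = t k) :: complex)" for a x s t :: "nat \<Rightarrow> nat"
  have I: "finite {1..n}" by simp
  \<comment> \<open>The matrix dimensions are known on \<open>space M\<close> only, so the
    integrands are compared there.\<close>
  have T: "mat_trace ((c \<cdot>\<^sub>m Z_mat l e d (G w) (H w)) ^\<^sub>m n) = T w" if "w \<in> space M" for w
    unfolding T_def V_def X_def Fd_def Fl_def
    using G H that unfolding ginibre_def by (intro mat_trace_Z_pow[OF e _ _ n]) auto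
  have sub: "(\<lambda>k. (a k * d + x k, s k)) ` {1..n} \<subseteq> {..<d * d} \<times> {..<l}"
      "(\<lambda>k. (a (long_cycle n k) * d + x k, s k)) ` {1..n} \<subseteq> {..<d * d} \<times> {..<l}"
    if "a \<in> Fd" "x \<in> Fd" "s \<in> Fl" for a x s
  proof -
    have "a k < d" "x k < d" "s k < l" "a (long_cycle n k) < d" if "k \<in> {1..n}" for k
      using \<open>a \<in> Fd\<close> \<open>x \<in> Fd\<close> \<open>s \<in> Fl\<close> that long_cycle_in[OF that] unfolding Fd_def Fl_def by auto
    then show "(\<lambda>k. (a k * d + x k, s k)) ` {1..n} \<subseteq> {..<d * d} \<times> {..<l}"
      "(\<lambda>k. (a (long_cycle n k) * d + x k, s k)) ` {1..n} \<subseteq> {..<d * d} \<times> {..<l}"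
      by (auto simp: index_pair_less)
  qed
  have iX: "integrable M (X K a x s t)" and eX: "expectation (X K a x s t) = N a x s t"
    if "ginibre M (d * d) l K" "a \<in> Fd" "x \<in> Fd" "s \<in> Fl" "t \<in> Fl" for K a x s t
  proof -
    note g = ginibre_wick[OF that(1) I sub(1)[OF that(2,3,4)] sub(2)[OF that(2,3,5)]]
    show "integrable M (X K a x s t)" unfolding X_def using g(1) .
    show "expectation (X K a x s t) = N a x s t" unfolding X_def N_def
      using g(2) card_wick_labels[OF that(2,3)[unfolded Fd_def], of s t] by simp
  qed
  have ind2: "indep_var borel (X G a x s t) borel (X H a' x' s' t')"
    if "a \<in> Fd" "x \<in> Fd" "s \<in> Fl" "t \<in> Fl" "a' \<in> Fd" "x' \<in> Fd" "s' \<in> Fl" "t' \<in> Fl" for a x s t a' x' s' t'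
    unfolding X_def using that by (intro indep_random_mats_prod[OF ind] sub)
  have i2: "integrable M (\<lambda>w. X G a x s t w * X H a' x' s' t' w)"
    and e2: "expectation (\<lambda>w. X G a x s t w * X H a' x' s' t' w) = N a x s t * N a' x' s' t'"
    if "a \<in> Fd" "x \<in> Fd" "s \<in> Fl" "t \<in> Fl" "a' \<in> Fd" "x' \<in> Fd" "s' \<in> Fl" "t' \<in> Fl" for a x s t a' x' s' t'
    using indep_var_integrable[OF ind2[OF that] iX[OF G that(1-4)] iX[OF H that(5-8)]]
      indep_var_lebesgue_integral[OF ind2[OF that] iX[OF G that(1-4)] iX[OF H that(5-8)]]
      eX[OF G that(1-4)] eX[OF H that(5-8)] by auto
  \<comment> \<open>This predicate carries integrability and the value of the integral together
    through the eightfold sum.\<close>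
  have "has_bochner_integral M T (c ^ n * (\<Sum>a\<in>Fd. \<Sum>a'\<in>Fd. \<Sum>s\<in>Fl. \<Sum>s'\<in>Fl. \<Sum>t\<in>Fl. \<Sum>t'\<in>Fl. \<Sum>x\<in>Fd. \<Sum>x'\<in>Fd.
      V s s' t t' * (N a x s t * N a' x' s' t')))"
    unfolding T_def using i2 e2
    by (intro has_bochner_integral_mult_right has_bochner_integral_sum) (auto simp: has_bochner_integral_iff)
  then have "has_bochner_integral M T (c ^ n * (\<Sum>p | p permutes {1..n}. \<Sum>q | q permutes {1..n}. C p * C q *
         of_nat l ^ num_cycles n (Hilbert_Choice.inv p \<circ> q)))"
    unfolding V_def N_def Fd_def Fl_def sum_contract[OF e] C_def .
  moreover have "?int \<longleftrightarrow> integrable M T"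
    by (rule Bochner_Integration.integrable_cong[OF refl T])
  moreover have "expectation (\<lambda>w. mat_trace ((c \<cdot>\<^sub>m Z_mat l e d (G w) (H w)) ^\<^sub>m n)) = expectation T"
    by (rule Bochner_Integration.integral_cong[OF refl T])
  ultimately show ?int ?exp by (simp_all add: has_bochner_integral_iff)
qed

end

text \<open>The quotient is a power of \<open>1 / d\<close> whose exponent is the defect in the
  genus bound.\<close>

lemma genus_limit:
  assumes "n \<ge> 1" "p permutes {1..n}"
  shows "(\<lambda>d. of_nat d ^ (num_cycles n p + num_cycles n (kreweras n p)) / of_nat d ^ Suc n)
    \<longlonglongrightarrow> (of_bool (nested n p) :: complex)"
proof -
  let ?m = "num_cycles n p + num_cycles n (kreweras n p)"
  have b: "?m \<le> Suc n" "?m = Suc n \<longleftrightarrow> nested n p" using genus_bound[OF assms] by auto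
  have lim: "(\<lambda>d. inverse (of_nat d) ^ (Suc n - ?m)) \<longlonglongrightarrow> (0 ^ (Suc n - ?m) :: complex)"
    by (intro tendsto_power lim_inverse_n)
  \<comment> \<open>Because \<open>0 ^ 0 = 1\<close>, the limit is 1 exactly when the defect
    vanishes.\<close>
  have val: "(0 ^ (Suc n - ?m) :: complex) = of_bool (nested n p)"
    using b by (cases "?m = Suc n") auto
  have "\<forall>\<^sub>F d in sequentially. inverse (of_nat d) ^ (Suc n - ?m) = (of_nat d ^ ?m / of_nat d ^ Suc n :: complex)"
    using eventually_gt_at_top[of 0]
  proof eventually_elim
    case (elim d)
    have "(of_nat d :: complex) ^ Suc n = of_nat d ^ ?m * of_nat d ^ (Suc n - ?m)"
      using b by (simp only: power_add[symmetric] le_add_diff_inverse)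
    then show ?case using elim by (simp add: field_simps)
  qed
  from Lim_transform_eventually[OF lim this] show ?thesis unfolding val .
qed

theorem theorem7p3:
  fixes l n :: nat
    and e :: "nat \<Rightarrow> complex Matrix.vec"
    and M :: "nat \<Rightarrow> 'w measure"
    and G H :: "nat \<Rightarrow> 'w \<Rightarrow> complex Matrix.mat"
  assumes "l \<ge> 1"
    and "orthonormal_basis l e"
    and "\<And>d. d \<ge> 1 \<Longrightarrow> prob_space (M d)"
    and "\<And>d. d \<ge> 1 \<Longrightarrow> ginibre (M d) (d * d) l (G d)"
    and "\<And>d. d \<ge> 1 \<Longrightarrow> ginibre (M d) (d * d) l (H d)"
    and "\<And>d. d \<ge> 1 \<Longrightarrow> indep_random_mats (M d) (d * d) l (G d) (H d)"
    and "n \<ge> 1"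
  shows "(\<forall>d\<ge>1. integrable (M d) (\<lambda>\<omega>. 1 / (of_nat d)\<^sup>2 *
             mat_trace ((1 / (of_nat d)\<^sup>2 \<cdot>\<^sub>m Z_mat l e d (G d \<omega>) (H d \<omega>)) ^\<^sub>m n))) \<and>
         (\<lambda>d. \<integral>\<omega>. 1 / (of_nat d)\<^sup>2 *
             mat_trace ((1 / (of_nat d)\<^sup>2 \<cdot>\<^sub>m Z_mat l e d (G d \<omega>) (H d \<omega>)) ^\<^sub>m n) \<partial>M d)
           \<longlonglongrightarrow> of_nat (nc_moment n l)"
proof
  let ?P = "{p. p permutes {1..n}}"
  let ?E = "\<lambda>p q. of_nat l ^ num_cycles n (Hilbert_Choice.inv p \<circ> q) :: complex"
  define r where "r d p = (of_nat d ^ (num_cycles n p + num_cycles n (kreweras n p)) / of_nat d ^ Suc n :: complex)" for d p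
  note Z = prob_space.expectation_trace_Z_pow[OF assms(3) assms(2) assms(4-6) assms(7)]
  show "\<forall>d\<ge>1. integrable (M d) (\<lambda>\<omega>. 1 / (of_nat d)\<^sup>2 *
             mat_trace ((1 / (of_nat d)\<^sup>2 \<cdot>\<^sub>m Z_mat l e d (G d \<omega>) (H d \<omega>)) ^\<^sub>m n))"
    using Z(1) by (intro allI impI integrable_mult_right) auto
  have fin: "finite ?P" by (intro finite_permutations) simp
  have "(\<lambda>d. \<Sum>p\<in>?P. \<Sum>q\<in>?P. r d p * r d q * ?E p q) \<longlonglongrightarrow>
      (\<Sum>p\<in>?P. \<Sum>q\<in>?P. of_bool (nested n p) * of_bool (nested n q) * ?E p q)"
    unfolding r_def using assms(7) by (intro tendsto_sum tendsto_mult genus_limit tendsto_const) auto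
  also have "(\<Sum>p\<in>?P. \<Sum>q\<in>?P. of_bool (nested n p) * of_bool (nested n q) * ?E p q) = of_nat (nc_moment n l)"
  proof -
    have *: "(\<Sum>p\<in>?P. of_bool (nested n p) * f p) = (\<Sum>p | p permutes {1..n} \<and> nested n p. f p)" for f :: "_ \<Rightarrow> complex"
      by (rule sum.mono_neutral_cong_right[OF fin]) auto
    show ?thesis unfolding nc_moment_eq
      by (simp only: mult.assoc sum_distrib_left[symmetric] * of_nat_sum of_nat_power)
  qed
  finally have lim: "(\<lambda>d. \<Sum>p\<in>?P. \<Sum>q\<in>?P. r d p * r d q * ?E p q) \<longlonglongrightarrow> of_nat (nc_moment n l)" .
  \<comment> \<open>The exact formula is available for \<open>d \<ge> 1\<close>, which is enough for
    the limit.\<close>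
  have "\<forall>\<^sub>F d in sequentially. (\<Sum>p\<in>?P. \<Sum>q\<in>?P. r d p * r d q * ?E p q) =
    (\<integral>\<omega>. 1 / (of_nat d)\<^sup>2 * mat_trace ((1 / (of_nat d)\<^sup>2 \<cdot>\<^sub>m Z_mat l e d (G d \<omega>) (H d \<omega>)) ^\<^sub>m n) \<partial>M d)"
    using eventually_ge_at_top[of 1]
  proof eventually_elim
    case (elim d)
    \<comment> \<open>The total normalisation is the square of \<open>1 / d ^ Suc n\<close>, one
      factor for each of the two permutations.\<close>
    have "1 / (of_nat d)\<^sup>2 * (1 / (of_nat d)\<^sup>2) ^ n = (1 / of_nat d ^ Suc n) * (1 / of_nat d ^ Suc n :: complex)"
      by (simp add: power_divide power_mult[symmetric] power_add[symmetric] mult_2 power2_eq_square power_mult_distrib)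
    then show ?case
      unfolding integral_mult_right_zero Z(2)[OF elim elim elim elim] mult.assoc[symmetric]
      unfolding r_def sum_distrib_left by (simp add: mult_ac)
  qed
  from Lim_transform_eventually[OF lim this]
  show "(\<lambda>d. \<integral>\<omega>. 1 / (of_nat d)\<^sup>2 *
             mat_trace ((1 / (of_nat d)\<^sup>2 \<cdot>\<^sub>m Z_mat l e d (G d \<omega>) (H d \<omega>)) ^\<^sub>m n) \<partial>M d)
           \<longlonglongrightarrow> of_nat (nc_moment n l)" .
qed

end
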